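(* For every integer $k \ge 1$ there is a connected graph on $14k$ vertices whose line graph has signature $k+1$. In particular $\sup\{\, s(L(G)) : G \text{ a connected graph} \,\} = \infty$; that is, there is no constant $C$ such that $n^{+}(L(G)) \le n^{-}(L(G)) + C$ for every connected graph $G$.
   Context: All graphs are finite and simple. For a graph $H$ with adjacency matrix $A(H)$, $n^{+}(H)$ and $n^{-}(H)$ denote the numbers of positive and negative eigenvalues of $A(H)$, counted with multiplicity, and the signature is $s(H) = n^{+}(H) - n^{-}(H)$. The line graph $L(G)$ has the edges of $G$ as vertices, two being adjacent when they are distinct and share an endpoint. *)

theory Defs
  imports
    "Graph_Theory.Graph_Theory"
    "Jordan_Normal_Form.Char_Poly"
    "HOL-Library.Extended_Real"
begin

text \<open>
  A finite simple graph is a \<^locale>\<open>pair_graph\<close>: finite, loop-free, and with a symmetric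
  arc relation, so that the undirected edge \<open>{u, v}\<close> is the pair of arcs \<open>(u, v)\<close>, \<open>(v, u)\<close>.
\<close>

definition edges :: "'a pair_pre_digraph \<Rightarrow> 'a set set" where
  "edges G = {{u, v} | u v. (u, v) \<in> parcs G}"

definition line_graph :: "'a pair_pre_digraph \<Rightarrow> 'a set pair_pre_digraph" where
  "line_graph G =
     \<lparr> pverts = edges G,
       parcs = {(e, f). e \<in> edges G \<and> f \<in> edges G \<and> e \<noteq> f \<and> e \<inter> f \<noteq> {}} \<rparr>"

lemma pair_graph_line_graph:
  assumes "pair_graph G"
  shows "pair_graph (line_graph G)"
proof -
  interpret pair_graph G by fact
  have "edges G = (\<lambda>(u, v). {u, v}) ` parcs G"
    by (auto simp: edges_def)
  hence fin: "finite (edges G)"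
    using pair_finite_arcs by simp
  have "parcs (line_graph G) \<subseteq> edges G \<times> edges G"
    by (auto simp: line_graph_def)
  hence "finite (parcs (line_graph G))"
    using fin finite_subset by blast
  thus ?thesis
    using fin by unfold_locales (auto simp: line_graph_def symmetric_def sym_def)
qed

definition adj_mat_wrt :: "'a pair_pre_digraph \<Rightarrow> 'a list \<Rightarrow> real mat" where
  "adj_mat_wrt G vs =
     mat (length vs) (length vs) (\<lambda>(i, j). if (vs ! i, vs ! j) \<in> parcs G then 1 else 0)"

text \<open>
  Matrices are indexed by numbers, so the vertices are listed in some order; the characteristic
  polynomial, and with it the spectrum, does not depend on the order chosen.
\<close>

definition adj_mat :: "'a pair_pre_digraph \<Rightarrow> real mat" where
  "adj_mat G = adj_mat_wrt G (SOME vs. distinct vs \<and> set vs = pverts G)"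

lemma char_poly_adj_mat_wrt_permute:
  assumes "distinct vs" "distinct ws" "set vs = set ws"
  shows "char_poly (adj_mat_wrt G vs) = char_poly (adj_mat_wrt G ws)"
proof -
  define n where "n = length vs"
  have len: "length ws = n"
    using assms distinct_card unfolding n_def by metis
  have "mset ws = mset vs"
    using assms set_eq_iff_mset_eq_distinct by blast
  then obtain p where p: "p permutes {..<n}" and ws: "ws = permute_list p vs"
    unfolding n_def by (elim mset_eq_permutation) auto
  have pn: "p i < n" if "i < n" for i
    using permutes_in_image[OF p] that by auto
  have inj: "p i = p j \<longleftrightarrow> i = j" for i j
    using permutes_inj[OF p] by (auto dest: injD)
  have wsi: "ws ! i = vs ! p i" if "i < n" for i
    using that p unfolding ws n_def by (simp add: permute_list_nth)
  define P :: "real mat" where "P = mat n n (\<lambda>(i, j). if j = p i then 1 else 0)"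
  define Q :: "real mat" where "Q = mat n n (\<lambda>(i, j). if i = p j then 1 else 0)"
  define A where "A = adj_mat_wrt G vs"
  define B where "B = adj_mat_wrt G ws"
  have car: "P \<in> carrier_mat n n" "Q \<in> carrier_mat n n" "A \<in> carrier_mat n n"
    "B \<in> carrier_mat n n"
    by (auto simp: P_def Q_def A_def B_def adj_mat_wrt_def n_def len[unfolded n_def])
  have PQ: "P * Q = 1\<^sub>m n"
    by (rule eq_matI)
       (auto simp: P_def Q_def scalar_prod_def pn inj if_distrib[of "\<lambda>x. x * _"]
             cong: if_cong)
  have QP: "Q * P = 1\<^sub>m n"
    using mat_mult_left_right_inverse[OF car(1,2) PQ] .
  have PA: "P * A = mat n n (\<lambda>(i, j). A $$ (p i, j))"
    using car by (intro eq_matI)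
       (auto simp: P_def scalar_prod_def pn if_distrib[of "\<lambda>x. x * _"] cong: if_cong)
  have "B = P * A * Q"
    unfolding PA using car
    by (intro eq_matI)
       (auto simp: Q_def B_def A_def adj_mat_wrt_def scalar_prod_def pn len wsi
                   n_def[symmetric] if_distrib[of "\<lambda>x. _ * x"] cong: if_cong)
  hence "similar_mat B A"
    unfolding similar_mat_def similar_mat_wit_def
    using car PQ QP by (intro exI[of _ P] exI[of _ Q]) (auto simp: Let_def)
  from char_poly_similar[OF this] show ?thesis
    by (simp add: A_def B_def)
qed

definition n_pos :: "'a pair_pre_digraph \<Rightarrow> nat" where
  "n_pos G = (\<Sum>x | eigenvalue (adj_mat G) x \<and> x > 0. order x (char_poly (adj_mat G)))"

definition n_neg :: "'a pair_pre_digraph \<Rightarrow> nat" where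
  "n_neg G = (\<Sum>x | eigenvalue (adj_mat G) x \<and> x < 0. order x (char_poly (adj_mat G)))"

definition signature :: "'a pair_pre_digraph \<Rightarrow> int" where
  "signature G = int (n_pos G) - int (n_neg G)"

end

theory Submission
  imports Defs "Jordan_Normal_Form.Spectral_Radius"
begin

text \<open>
  For an edge weighting \<open>x\<close> let \<open>y v\<close> be the sum of \<open>x\<close> over the edges at \<open>v\<close>. The adjacency form of
  the line graph is \<open>q x = |y|^2 - 2 |x|^2\<close>, so with \<open>M = A + D - 2 I\<close> (\<open>D\<close> the degree matrix) one has
  \<open>q x = (y, M y) / 2 - 2 \<Sum> (x e - (y u + y v) / 2)^2\<close>. Adding an edge \<open>u v\<close> to the graph adds
  \<open>(y u + y v)^2\<close> to the form of \<open>M\<close>.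

  The graph is a chain of \<open>k\<close> copies of a connected block with 14 vertices and 16 edges, whose \<open>M\<close> has
  9 positive and 5 negative eigenvalues; a 5-dimensional negative subspace for \<open>M\<close> vanishes at the
  vertex by which the blocks are linked, so the linking edges do no harm. Hence \<open>q\<close> is negative
  definite on a subspace of codimension \<open>9 k\<close>, cut out by conditions on \<open>y\<close>. It is positive definite
  on a subspace of codimension \<open>7 k + (k - 1)\<close>: make \<open>x\<close> vanish on the linking edges and impose 7
  equations in every block. As there are \<open>17 k - 1\<close> edges, \<open>q\<close> has inertia \<open>(9 k, 8 k - 1)\<close>.
\<close>

section \<open>Real symmetric matrices and inertia\<close>

lemma index_mult_mat_vec_sum:
  assumes "A \<in> carrier_mat nr nc" "v \<in> carrier_vec nc" "i < nr"
  shows "(A *\<^sub>v v) $ i = (\<Sum>j<nc. A $$ (i, j) * v $ j)"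
  using assms by (auto simp: scalar_prod_def atLeast0LessThan intro!: sum.cong)

text \<open>Over the complex numbers an eigenpair \<open>z\<close>, \<open>w\<close> exists because
  \<open>n > 0\<close>. By symmetry the Hermitian form \<open>S\<close> of \<open>A\<close> at
  \<open>w\<close> is real, and it equals \<open>z\<close> times the positive number
  \<open>N\<close>, so \<open>z\<close> is real.\<close>

lemma symmetric_mat_real_eigenvector:
  fixes A :: "real mat"
  assumes A: "A \<in> carrier_mat n n" and sym: "A\<^sup>T = A" and n: "n > 0"
  obtains l v where "v \<in> carrier_vec n" "v \<noteq> 0\<^sub>v n" "A *\<^sub>v v = l \<cdot>\<^sub>v v"
proof -
  define AC where "AC = map_mat complex_of_real A"
  have AC: "AC \<in> carrier_mat n n" using A by (simp add: AC_def)
  obtain z where "eigenvalue AC z"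
    using spectrum_non_empty[OF AC n] by (auto simp: spectrum_def)
  then obtain w where w: "w \<in> carrier_vec n" "w \<noteq> 0\<^sub>v n" "AC *\<^sub>v w = z \<cdot>\<^sub>v w"
    using AC by (auto simp: eigenvalue_def eigenvector_def)
  have symi: "A $$ (i, j) = A $$ (j, i)" if "i < n" "j < n" for i j
    using arg_cong[OF sym, of "\<lambda>M. M $$ (i, j)"] A that by simp
  have row: "(\<Sum>j<n. of_real (A $$ (i, j)) * w $ j) = z * w $ i" if "i < n" for i
  proof -
    have "(AC *\<^sub>v w) $ i = (\<Sum>j<n. of_real (A $$ (i, j)) * w $ j)"
      using index_mult_mat_vec_sum[OF AC w(1) that] A that by (simp add: AC_def)
    thus ?thesis using w that by simp
  qed
  define S where "S = (\<Sum>i<n. \<Sum>j<n. of_real (A $$ (i, j)) * cnj (w $ i) * w $ j)"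
  define N where "N = (\<Sum>i<n. (cmod (w $ i))\<^sup>2)"
  have "S = (\<Sum>i<n. cnj (w $ i) * (\<Sum>j<n. of_real (A $$ (i, j)) * w $ j))"
    unfolding S_def by (simp add: sum_distrib_left mult_ac)
  also have "\<dots> = (\<Sum>i<n. cnj (w $ i) * (z * w $ i))"
    by (intro sum.cong refl) (simp add: row)
  also have "\<dots> = z * of_real N"
    unfolding N_def of_real_sum sum_distrib_left
    by (intro sum.cong refl) (simp only: complex_norm_square mult_ac)
  finally have S: "S = z * of_real N" .
  have "cnj S = (\<Sum>i<n. \<Sum>j<n. of_real (A $$ (i, j)) * w $ i * cnj (w $ j))"
    unfolding S_def by simp
  also have "\<dots> = (\<Sum>j<n. \<Sum>i<n. of_real (A $$ (i, j)) * w $ i * cnj (w $ j))"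
    by (rule sum.swap)
  also have "\<dots> = S"
    unfolding S_def by (intro sum.cong refl) (simp add: symi mult_ac)
  finally have "cnj S = S" .
  obtain k where k: "k < n" "w $ k \<noteq> 0"
    using w by (metis carrier_vecD eq_vecI index_zero_vec)
  have "N > 0"
    unfolding N_def using k by (intro sum_pos2[of _ k]) auto
  with S \<open>cnj S = S\<close> have "cnj z = z" by auto
  then obtain l where l: "z = of_real l" by (metis Reals_cases Reals_cnj_iff)
  \<comment> \<open>Since \<open>A\<close> and \<open>l\<close> are real, the real and imaginary
    parts of \<open>w\<close> each satisfy the eigenvector equation; one of them is nonzero at
    coordinate \<open>k\<close>.\<close>
  have "\<exists>v \<in> carrier_vec n. v \<noteq> 0\<^sub>v n \<and> A *\<^sub>v v = l \<cdot>\<^sub>v v"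
  proof (cases "Re (w $ k) = 0")
    case False
    define v where "v = vec n (\<lambda>i. Re (w $ i))"
    have v: "v \<in> carrier_vec n" by (simp add: v_def)
    have "(A *\<^sub>v v) $ i = l * v $ i" if "i < n" for i
      using index_mult_mat_vec_sum[OF A v that] arg_cong[OF row[OF that], of Re] that
      by (simp add: v_def l)
    hence "A *\<^sub>v v = l \<cdot>\<^sub>v v" using A v by (intro eq_vecI) auto
    moreover have "v \<noteq> 0\<^sub>v n"
      using False k by (auto simp: v_def dest!: arg_cong[where f = "\<lambda>v. v $ k"])
    ultimately show ?thesis using v by blast
  next
    case True
    define v where "v = vec n (\<lambda>i. Im (w $ i))"
    have v: "v \<in> carrier_vec n" by (simp add: v_def)
    have "(A *\<^sub>v v) $ i = l * v $ i" if "i < n" for i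
      using index_mult_mat_vec_sum[OF A v that] arg_cong[OF row[OF that], of Im] that
      by (simp add: v_def l)
    hence "A *\<^sub>v v = l \<cdot>\<^sub>v v" using A v by (intro eq_vecI) auto
    moreover have "v \<noteq> 0\<^sub>v n"
      using True k by (auto simp: v_def complex_eq_iff dest!: arg_cong[where f = "\<lambda>v. v $ k"])
    ultimately show ?thesis using v by blast
  qed
  thus ?thesis using that by blast
qed

lemma orthogonal_mat_with_first_column:
  fixes v :: "real vec"
  assumes v: "v \<in> carrier_vec n" and unit: "v \<bullet> v = 1" and n: "n > 0"
  obtains H where "H \<in> carrier_mat n n" "H\<^sup>T * H = 1\<^sub>m n" "col H 0 = v"
proof -
  \<comment> \<open>Householder reflection; if \<open>w = 0\<close> then \<open>b = 0\<close> and \<open>H\<close> is the identity.\<close>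
  define w where "w = v - unit_vec n 0"
  define b where "b = 2 / (w \<bullet> w)"
  define H where "H = mat n n (\<lambda>(i, j). (if i = j then 1 else 0) - b * w $ i * w $ j)"
  have w: "w \<in> carrier_vec n" using v by (simp add: w_def)
  have wi: "w $ i = v $ i - (if i = 0 then 1 else 0)" if "i < n" for i
    using that n v by (simp add: w_def unit_vec_def)
  have ww: "w \<bullet> w = (\<Sum>i<n. w $ i * w $ i)"
    using w by (simp add: scalar_prod_def atLeast0LessThan)
  have vv: "(\<Sum>i<n. v $ i * v $ i) = 1"
    using unit v by (simp add: scalar_prod_def atLeast0LessThan)
  have "w \<bullet> w = (\<Sum>i<n. v $ i * v $ i - (if i = 0 then 2 * v $ 0 - 1 else 0))"
    unfolding ww by (intro sum.cong refl) (simp add: wi algebra_simps)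
  hence w0: "w \<bullet> w = - 2 * w $ 0"
    using n vv wi[OF n] by (simp add: sum_subtractf)
  have bb: "b * b * (w \<bullet> w) = 2 * b" by (simp add: b_def)
  have H: "H \<in> carrier_mat n n" by (simp add: H_def)
  have "(H\<^sup>T * H) $$ (i, j) = (if i = j then 1 else 0)" if ij: "i < n" "j < n" for i j
  proof -
    have "(H\<^sup>T * H) $$ (i, j) = (\<Sum>k<n. H $$ (k, i) * H $$ (k, j))"
      using H ij by (auto simp: scalar_prod_def atLeast0LessThan intro!: sum.cong)
    also have "\<dots> = (\<Sum>k<n. (if k = i then if i = j then 1 else 0 else 0)
        - (if k = i then b * w $ i * w $ j else 0) - (if k = j then b * w $ i * w $ j else 0)
        + b * b * w $ i * w $ j * (w $ k * w $ k))"
      by (intro sum.cong refl) (use ij in \<open>auto simp: H_def algebra_simps\<close>)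
    also have "\<dots> = (if i = j then 1 else 0) - 2 * b * w $ i * w $ j + b * b * (w \<bullet> w) * w $ i * w $ j"
      using ij by (simp add: sum.distrib sum_subtractf ww sum_distrib_left algebra_simps)
    also have "\<dots> = (if i = j then 1 else 0)" unfolding bb by simp
    finally show ?thesis .
  qed
  hence HH: "H\<^sup>T * H = 1\<^sub>m n" using H by (intro eq_matI) auto
  have "col H 0 $ i = v $ i" if i: "i < n" for i
  proof (cases "w \<bullet> w = 0")
    case True
    hence "\<forall>i<n. w $ i = 0" unfolding ww by (simp add: sum_nonneg_eq_0_iff)
    thus ?thesis using i n wi by (simp add: H_def)
  next
    case False
    \<comment> \<open>From \<open>w0\<close>, so the first column of \<open>H\<close> is the first
      unit vector plus \<open>w\<close>, which is \<open>v\<close>.\<close>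
    hence "b * w $ 0 = - 1" using w0 by (simp add: b_def field_simps)
    hence "b * w $ i * w $ 0 = - w $ i" by (metis mult.assoc mult.commute mult_minus1)
    thus ?thesis using i n wi[OF i] by (simp add: H_def)
  qed
  hence "col H 0 = v" using H v by (intro eq_vecI) auto
  with H HH show ?thesis by (rule that)
qed

text \<open>Deflation by induction on \<open>n\<close>: conjugating by an orthogonal
  \<open>H\<close> whose first column is a unit eigenvector gives \<open>B\<close> with first column
  \<open>l\<close> times a unit vector. Symmetry clears the rest of the first row, and the induction
  hypothesis diagonalizes the remaining block \<open>C\<close>.\<close>

theorem real_symmetric_mat_diagonalization:
  fixes A :: "real mat"
  assumes "A \<in> carrier_mat n n" "A\<^sup>T = A"
  obtains U D where "U \<in> carrier_mat n n" "D \<in> carrier_mat n n" "diagonal_mat D"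
    "U\<^sup>T * U = 1\<^sub>m n" "A = U * D * U\<^sup>T"
proof -
  have "\<exists>U D. U \<in> carrier_mat n n \<and> D \<in> carrier_mat n n \<and> diagonal_mat D \<and> U\<^sup>T * U = 1\<^sub>m n
      \<and> A = U * D * U\<^sup>T"
    using assms
  proof (induction n arbitrary: A)
    case 0
    thus ?case by (intro exI[of _ "1\<^sub>m 0"]) (auto simp: diagonal_mat_def)
  next
    case (Suc m)
    note A = Suc.prems(1) and sym = Suc.prems(2)
    obtain l v where v: "v \<in> carrier_vec (Suc m)" "v \<noteq> 0\<^sub>v (Suc m)" "A *\<^sub>v v = l \<cdot>\<^sub>v v"
      by (rule symmetric_mat_real_eigenvector[OF A sym]) auto
    define u where "u = (1 / sqrt (v \<bullet> v)) \<cdot>\<^sub>v v"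
    have "v \<bullet> v > 0" using conjugate_square_greater_0_vec[OF v(1)] v(2) by simp
    hence u: "u \<in> carrier_vec (Suc m)" "u \<bullet> u = 1"
      using v by (auto simp: u_def)
    have Au: "A *\<^sub>v u = l \<cdot>\<^sub>v u"
      using A v by (simp add: u_def mult_mat_vec smult_smult_assoc mult.commute)
    obtain H where H: "H \<in> carrier_mat (Suc m) (Suc m)" "H\<^sup>T * H = 1\<^sub>m (Suc m)" "col H 0 = u"
      using orthogonal_mat_with_first_column[OF u] by auto
    have HT: "H\<^sup>T \<in> carrier_mat (Suc m) (Suc m)" using H by simp
    have HH: "H * H\<^sup>T = 1\<^sub>m (Suc m)" using mat_mult_left_right_inverse[OF HT H(1,2)] .
    define B where "B = H\<^sup>T * (A * H)"
    have B: "B \<in> carrier_mat (Suc m) (Suc m)" using A H by (simp add: B_def)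
    have symB: "B\<^sup>T = B"
      using A H HT sym by (simp add: B_def transpose_mult[of _ "Suc m" "Suc m" _ "Suc m"]
          assoc_mult_mat[of _ "Suc m" "Suc m" _ "Suc m" _ "Suc m"])
    have symBi: "B $$ (i, j) = B $$ (j, i)" if "i < Suc m" "j < Suc m" for i j
      using arg_cong[OF symB, of "\<lambda>M. M $$ (i, j)"] B that by simp
    \<comment> \<open>\<open>A\<close> scales the first column of \<open>H\<close> by
      \<open>l\<close>, and the transpose of \<open>H\<close> sends that column back to the first
      unit vector.\<close>
    have "col B 0 = H\<^sup>T *\<^sub>v col (A * H) 0"
      unfolding B_def using A H(1) by (intro col_mult2[OF HT]) auto
    also have "col (A * H) 0 = A *\<^sub>v col H 0"
      by (rule col_mult2[OF A H(1)]) simp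
    also have "H\<^sup>T *\<^sub>v (A *\<^sub>v col H 0) = l \<cdot>\<^sub>v (H\<^sup>T *\<^sub>v col H 0)"
      using H(1) u HT by (simp add: H(3) Au mult_mat_vec)
    also have "H\<^sup>T *\<^sub>v col H 0 = col (H\<^sup>T * H) 0"
      by (rule col_mult2[OF HT H(1), symmetric]) simp
    also have "\<dots> = unit_vec (Suc m) 0" using H(2) by simp
    finally have colB: "col B 0 = l \<cdot>\<^sub>v unit_vec (Suc m) 0" .
    have B0: "B $$ (i, 0) = (if i = 0 then l else 0)" if "i < Suc m" for i
      using arg_cong[OF colB, of "\<lambda>x. x $ i"] B that by (auto simp: unit_vec_def)
    define C where "C = mat m m (\<lambda>(i, j). B $$ (Suc i, Suc j))"
    have C: "C \<in> carrier_mat m m" "C\<^sup>T = C"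
      by (auto simp: C_def symBi)
    obtain U D where U: "U \<in> carrier_mat m m" and D: "D \<in> carrier_mat m m" and dD: "diagonal_mat D"
      and UU: "U\<^sup>T * U = 1\<^sub>m m" and CU: "C = U * D * U\<^sup>T"
      using Suc.IH[OF C] by blast
    define L where "L = mat 1 1 (\<lambda>_. l)"
    have L: "L \<in> carrier_mat 1 1" by (simp add: L_def)
    define W where "W = four_block_mat (1\<^sub>m 1) (0\<^sub>m 1 m) (0\<^sub>m m 1) U"
    define E where "E = four_block_mat L (0\<^sub>m 1 m) (0\<^sub>m m 1) D"
    have W: "W \<in> carrier_mat (Suc m) (Suc m)" and E: "E \<in> carrier_mat (Suc m) (Suc m)"
      using U D L four_block_carrier_mat[of _ 1 1 _ m m] by (auto simp: W_def E_def)
    have WT: "W\<^sup>T = four_block_mat (1\<^sub>m 1) (0\<^sub>m 1 m) (0\<^sub>m m 1) (U\<^sup>T)"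
      using U by (simp add: W_def transpose_four_block_mat[of _ 1 1 _ m _ m])
    have UT: "U\<^sup>T \<in> carrier_mat m m" using U by simp
    note mfb = mult_four_block_mat[of _ 1 1 _ m _ m _ _ 1 _ m]
    have WW: "W\<^sup>T * W = 1\<^sub>m (Suc m)"
      unfolding WT unfolding W_def using U UT UU
      by (subst mfb) (auto simp: four_block_one_mat[of 1 m, simplified])
    have "W * E = four_block_mat L (0\<^sub>m 1 m) (0\<^sub>m m 1) (U * D)"
      unfolding W_def E_def using U D L by (subst mfb) auto
    hence "W * E * W\<^sup>T = four_block_mat L (0\<^sub>m 1 m) (0\<^sub>m m 1) C"
      unfolding WT CU using U UT D L by (simp add: mfb[of L _ _ "U * D"])
    also have "\<dots> = B"
    proof (rule eq_matI)
      fix i j assume "i < dim_row B" "j < dim_col B"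
      hence "i < Suc m" "j < Suc m" using B by auto
      thus "four_block_mat L (0\<^sub>m 1 m) (0\<^sub>m m 1) C $$ (i, j) = B $$ (i, j)"
        using L C B0 symBi[of 0] by (cases i; cases j) (auto simp: C_def L_def)
    qed (use L C B in auto)
    finally have BW: "W * E * W\<^sup>T = B" .
    have WTc: "W\<^sup>T \<in> carrier_mat (Suc m) (Suc m)" using W by simp
    note carr = A H(1) HT B W WTc E
    note assoc = assoc_mult_mat[of _ "Suc m" "Suc m" _ "Suc m" _ "Suc m"]
    have "A = (H * H\<^sup>T) * A * (H * H\<^sup>T)" using A HH by simp
    also have "\<dots> = H * B * H\<^sup>T" unfolding B_def using carr by (simp add: assoc)
    also have "\<dots> = (H * W) * E * (H * W)\<^sup>T"
      unfolding BW[symmetric] using carr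
      by (simp add: assoc transpose_mult[of _ "Suc m" "Suc m" _ "Suc m"])
    finally have AW: "A = (H * W) * E * (H * W)\<^sup>T" .
    have "(H * W)\<^sup>T * (H * W) = W\<^sup>T * ((H\<^sup>T * H) * W)"
      using carr by (simp add: assoc transpose_mult[of _ "Suc m" "Suc m" _ "Suc m"])
    also have "\<dots> = 1\<^sub>m (Suc m)" using H(2) W WW by simp
    finally have "(H * W)\<^sup>T * (H * W) = 1\<^sub>m (Suc m)" .
    moreover have "diagonal_mat E"
      using D L dD by (auto simp: diagonal_mat_def E_def)
    moreover have "H * W \<in> carrier_mat (Suc m) (Suc m)" using H W by simp
    ultimately show ?case using AW E by blast
  qed
  thus ?thesis using that by blast
qed

section \<open>Eigenvalue counts bounded by codimensions of definite subspaces\<close>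

text \<open>The order of \<open>x\<close> in \<open>p\<close> is the size of the fibre of
  \<open>d\<close> over \<open>x\<close>, so the sum counts indices fibre by fibre.\<close>

lemma sum_order_prod_linear:
  fixes d :: "nat \<Rightarrow> real"
  assumes p: "p = (\<Prod>i\<leftarrow>[0..<n]. [:- d i, 1:])"
  shows "(\<Sum>x | poly p x = 0 \<and> P x. order x p) = card {i. i < n \<and> P (d i)}"
proof -
  have ord: "order x p = card {i. i < n \<and> d i = x}" for x
  proof -
    have "order x p = (\<Sum>i\<leftarrow>[0..<n]. order x [:- d i, 1:])"
      unfolding p by (subst order_prod_list) (auto simp: o_def)
    also have "\<dots> = (\<Sum>i\<leftarrow>[0..<n]. if d i = x then 1 else 0)"
      by (intro arg_cong[where f = sum_list] map_cong refl) (simp add: order_linear')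
    also have "\<dots> = (\<Sum>i\<in>{0..<n}. if d i = x then 1 else 0)"
      by (simp add: interv_sum_list_conv_sum_set_nat)
    also have "\<dots> = card {i. i < n \<and> d i = x}"
      by (simp add: sum.If_cases Int_def)
    finally show ?thesis .
  qed
  have root: "poly p x = 0 \<longleftrightarrow> (\<exists>i<n. d i = x)" for x
    unfolding p poly_prod_list prod_list_zero_iff by auto
  have "card {i. i < n \<and> P (d i)} = (\<Sum>i | i < n \<and> P (d i). 1)" by simp
  also have "\<dots> = (\<Sum>x\<in>d ` {i. i < n \<and> P (d i)}. \<Sum>i | i \<in> {i. i < n \<and> P (d i)} \<and> d i = x. 1)"
    by (subst sum.image_gen[where g = d]) auto
  also have "\<dots> = (\<Sum>x | poly p x = 0 \<and> P x. order x p)"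
  proof (rule sum.cong)
    show "d ` {i. i < n \<and> P (d i)} = {x. poly p x = 0 \<and> P x}"
      by (auto simp: root)
  next
    fix x assume "x \<in> {x. poly p x = 0 \<and> P x}"
    hence "{i. i \<in> {i. i < n \<and> P (d i)} \<and> d i = x} = {i. i < n \<and> d i = x}" by auto
    thus "(\<Sum>i | i \<in> {i. i < n \<and> P (d i)} \<and> d i = x. 1) = order x p"
      by (simp add: ord)
  qed
  finally show ?thesis by simp
qed

text \<open>Gaussian elimination, one equation per induction step: an equation \<open>g\<close> with
  a nonzero coefficient at \<open>j0\<close> is solved for that unknown and substituted into the
  others, which leaves one equation and one unknown fewer.\<close>

lemma homogeneous_system_nontrivial:
  fixes a :: "'f \<Rightarrow> 'j \<Rightarrow> real"
  assumes "finite F" "finite J" "card F < card J"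
  obtains c where "\<exists>j\<in>J. c j \<noteq> 0" "\<And>f. f \<in> F \<Longrightarrow> (\<Sum>j\<in>J. c j * a f j) = 0"
proof -
  have "\<exists>c. (\<exists>j\<in>J. c j \<noteq> 0) \<and> (\<forall>f\<in>F. (\<Sum>j\<in>J. c j * a f j) = 0)"
    using assms
  proof (induction F arbitrary: J a rule: finite_induct)
    case empty
    then obtain j where "j \<in> J" by (metis card.empty card_gt_0_iff ex_in_conv)
    thus ?case by (intro exI[of _ "\<lambda>_. 1"]) auto
  next
    case (insert g F)
    show ?case
    proof (cases "\<forall>j\<in>J. a g j = 0")
      case True
      have "card F < card J" using insert by simp
      then obtain c where c: "\<exists>j\<in>J. c j \<noteq> 0" "\<forall>f\<in>F. (\<Sum>j\<in>J. c j * a f j) = 0"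
        using insert.IH[OF insert.prems(1)] by blast
      thus ?thesis using True by (intro exI[of _ c]) auto
    next
      case False
      then obtain j0 where j0: "j0 \<in> J" "a g j0 \<noteq> 0" by auto
      define K where "K = J - {j0}"
      have K: "finite K" "card F < card K"
        using insert j0 by (auto simp: K_def)
      obtain c where c: "\<exists>j\<in>K. c j \<noteq> 0"
        "\<forall>f\<in>F. (\<Sum>j\<in>K. c j * (a f j - a f j0 / a g j0 * a g j)) = 0"
        using insert.IH[OF K, of "\<lambda>f j. a f j - a f j0 / a g j0 * a g j"] by blast
      \<comment> \<open>The value at \<open>j0\<close> is the one forced by equation
        \<open>g\<close>.\<close>
      define c' where "c' = c(j0 := - (\<Sum>j\<in>K. c j * a g j) / a g j0)"
      have split: "(\<Sum>j\<in>J. c' j * a f j)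
          = (\<Sum>j\<in>K. c j * a f j) - (\<Sum>j\<in>K. c j * a g j) / a g j0 * a f j0" for f
      proof -
        have "(\<Sum>j\<in>J. c' j * a f j) = c' j0 * a f j0 + (\<Sum>j\<in>K. c' j * a f j)"
          unfolding K_def using insert.prems(1) j0(1) by (rule sum.remove)
        also have "(\<Sum>j\<in>K. c' j * a f j) = (\<Sum>j\<in>K. c j * a f j)"
          by (intro sum.cong) (auto simp: c'_def K_def)
        finally show ?thesis by (simp add: c'_def)
      qed
      have "(\<Sum>j\<in>J. c' j * a f j) = 0" if "f \<in> insert g F" for f
      proof (cases "f = g")
        case True
        thus ?thesis unfolding split using j0 by simp
      next
        case False
        hence "(\<Sum>j\<in>K. c j * (a f j - a f j0 / a g j0 * a g j)) = 0" using c that by blast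
        thus ?thesis unfolding split
          by (simp add: right_diff_distrib sum_subtractf sum_distrib_left sum_distrib_right
              sum_divide_distrib mult_ac)
      qed
      moreover have "\<exists>j\<in>J. c' j \<noteq> 0" using c(1) by (auto simp: c'_def K_def)
      ultimately show ?thesis by blast
    qed
  qed
  thus ?thesis using that by blast
qed

definition linear_form :: "(('a \<Rightarrow> real) \<Rightarrow> real) \<Rightarrow> bool" where
  "linear_form g \<longleftrightarrow>
     (\<forall>x y. g (\<lambda>v. x v + y v) = g x + g y) \<and> (\<forall>c x. g (\<lambda>v. c * x v) = c * g x)"

lemma linear_form_sum:
  assumes g: "linear_form g" and J: "finite J"
  shows "g (\<lambda>v. \<Sum>j\<in>J. c j * b j v) = (\<Sum>j\<in>J. c j * g (b j))"
  using J
proof (induction J rule: finite_induct)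
  case empty
  have "g (\<lambda>v. c * x v) = c * g x" for c x using g by (simp add: linear_form_def)
  from this[of 0 "\<lambda>_. 0"] show ?case by simp
next
  case (insert j J)
  have "g (\<lambda>v. c j * b j v + (\<Sum>j\<in>J. c j * b j v)) = c j * g (b j) + g (\<lambda>v. \<Sum>j\<in>J. c j * b j v)"
    using g unfolding linear_form_def by metis
  thus ?case using insert by simp
qed

lemma quadratic_form_diagonalization:
  fixes A :: "real mat"
  assumes U: "U \<in> carrier_mat n n" and D: "D \<in> carrier_mat n n" and dD: "diagonal_mat D"
    and UU: "U\<^sup>T * U = 1\<^sub>m n" and A: "A = U * D * U\<^sup>T" and c: "c \<in> carrier_vec n"
  shows "(U *\<^sub>v c) \<bullet> (A *\<^sub>v (U *\<^sub>v c)) = (\<Sum>i<n. D $$ (i, i) * (c $ i)\<^sup>2)"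
proof -
  have UT: "U\<^sup>T \<in> carrier_mat n n" using U by simp
  have Uc: "U\<^sup>T *\<^sub>v (U *\<^sub>v c) = c"
    using assoc_mult_mat_vec[OF UT U c] UU c by simp
  have Dc: "D *\<^sub>v c \<in> carrier_vec n" using D c by simp
  have "A *\<^sub>v (U *\<^sub>v c) = (U * D) *\<^sub>v (U\<^sup>T *\<^sub>v (U *\<^sub>v c))"
    unfolding A using U D UT c by (intro assoc_mult_mat_vec) auto
  also have "\<dots> = U *\<^sub>v (D *\<^sub>v c)"
    unfolding Uc using U D c by (rule assoc_mult_mat_vec)
  finally have "(U *\<^sub>v c) \<bullet> (A *\<^sub>v (U *\<^sub>v c)) = (U *\<^sub>v c) \<bullet> (U *\<^sub>v (D *\<^sub>v c))" by simp
  also have "\<dots> = (U\<^sup>T *\<^sub>v (U *\<^sub>v c)) \<bullet> (D *\<^sub>v c)"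
    using transpose_vec_mult_scalar[OF U Dc, of "U *\<^sub>v c"] U c by simp
  also have "\<dots> = (\<Sum>i<n. c $ i * (\<Sum>j<n. D $$ (i, j) * c $ j))"
    unfolding Uc using D
    by (simp add: scalar_prod_def[of c] atLeast0LessThan index_mult_mat_vec_sum[OF D c]
        del: index_mult_mat_vec)
  also have "\<dots> = (\<Sum>i<n. D $$ (i, i) * (c $ i)\<^sup>2)"
  proof (intro sum.cong refl)
    fix i assume "i \<in> {..<n}"
    moreover have "(\<Sum>j<n. D $$ (i, j) * c $ j) = (\<Sum>j<n. if j = i then D $$ (i, i) * c $ i else 0)"
      using dD D \<open>i \<in> {..<n}\<close> by (intro sum.cong) (auto simp: diagonal_mat_def)
    ultimately show "c $ i * (\<Sum>j<n. D $$ (i, j) * c $ j) = D $$ (i, i) * (c $ i)\<^sup>2"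
      by (simp add: power2_eq_square)
  qed
  finally show ?thesis .
qed

text \<open>The columns of \<open>U\<close> with \<open>s * D $$ (i, i) \<le> 0\<close> span a space
  on which \<open>s\<close> times the form is nonpositive. Were there more of them than forms in
  \<open>F\<close>, some nontrivial combination would be annihilated by \<open>F\<close>, against
  \<open>pos\<close>. The sign \<open>s\<close> is 1 or -1 in the applications.\<close>

lemma card_nonpos_diagonal_le:
  fixes A :: "real mat" and s :: real
  assumes U: "U \<in> carrier_mat n n" and D: "D \<in> carrier_mat n n" and dD: "diagonal_mat D"
    and UU: "U\<^sup>T * U = 1\<^sub>m n" and A: "A = U * D * U\<^sup>T"
    and vs: "distinct vs" "length vs = n"
    and F: "finite F" "\<And>g. g \<in> F \<Longrightarrow> linear_form g"
    and pos: "\<And>x. (\<And>g. g \<in> F \<Longrightarrow> g x = 0) \<Longrightarrow> \<exists>v\<in>set vs. x v \<noteq> 0 \<Longrightarrow>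
      0 < s * (\<Sum>i<n. \<Sum>j<n. A $$ (i, j) * x (vs ! i) * x (vs ! j))"
  shows "card {i. i < n \<and> \<not> 0 < s * D $$ (i, i)} \<le> card F"
proof (rule ccontr)
  define J where "J = {i. i < n \<and> \<not> 0 < s * D $$ (i, i)}"
  assume "\<not> ?thesis"
  hence card: "card F < card J" by (simp add: J_def)
  have J: "finite J" by (simp add: J_def)
  \<comment> \<open>Column \<open>j\<close> of \<open>U\<close> transported from indices to
    vertices; as \<open>vs\<close> is distinct, at most one summand survives.\<close>
  define b where "b j v = (\<Sum>i<n. if vs ! i = v then U $$ (i, j) else 0)" for j v
  have b: "b j (vs ! i) = U $$ (i, j)" if "i < n" for i j
  proof -
    have "b j (vs ! i) = (\<Sum>k<n. if k = i then U $$ (i, j) else 0)"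
      unfolding b_def using vs that by (intro sum.cong refl) (auto simp: nth_eq_iff_index_eq)
    thus ?thesis using that by simp
  qed
  obtain c where c: "\<exists>j\<in>J. c j \<noteq> 0" "\<And>g. g \<in> F \<Longrightarrow> (\<Sum>j\<in>J. c j * g (b j)) = 0"
    using homogeneous_system_nontrivial[OF F(1) J card, of "\<lambda>g j. g (b j)"] by blast
  define x where "x v = (\<Sum>j\<in>J. c j * b j v)" for v
  have gx: "g x = 0" if "g \<in> F" for g
    using linear_form_sum[OF F(2)[OF that] J, of c b] c(2)[OF that] by (simp add: x_def[abs_def])
  define cv where "cv = vec n (\<lambda>j. if j \<in> J then c j else 0)"
  have cv: "cv \<in> carrier_vec n" by (simp add: cv_def)
  define y where "y = U *\<^sub>v cv"
  have y: "y \<in> carrier_vec n" using U cv by (simp add: y_def)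
  have xy: "x (vs ! i) = y $ i" if "i < n" for i
  proof -
    have "y $ i = (\<Sum>j<n. U $$ (i, j) * cv $ j)"
      unfolding y_def using index_mult_mat_vec_sum[OF U cv that] .
    also have "\<dots> = (\<Sum>j<n. if j \<in> J then c j * U $$ (i, j) else 0)"
      by (intro sum.cong) (auto simp: cv_def)
    also have "\<dots> = (\<Sum>j\<in>J. c j * U $$ (i, j))"
      by (intro sum.mono_neutral_cong_right) (auto simp: J_def)
    finally show ?thesis using b[OF that] by (simp add: x_def)
  qed
  have Ac: "A \<in> carrier_mat n n" using U D by (auto simp: A)
  have "(\<Sum>i<n. \<Sum>j<n. A $$ (i, j) * x (vs ! i) * x (vs ! j)) = (\<Sum>i<n. y $ i * (A *\<^sub>v y) $ i)"
    using index_mult_mat_vec_sum[OF Ac y]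
    by (intro sum.cong refl) (auto simp: xy sum_distrib_left mult_ac intro!: sum.cong)
  also have "\<dots> = y \<bullet> (A *\<^sub>v y)" using Ac by (simp add: scalar_prod_def atLeast0LessThan)
  also have "\<dots> = (\<Sum>i<n. D $$ (i, i) * (cv $ i)\<^sup>2)"
    unfolding y_def by (rule quadratic_form_diagonalization[OF U D dD UU A cv])
  finally have "s * (\<Sum>i<n. \<Sum>j<n. A $$ (i, j) * x (vs ! i) * x (vs ! j))
      = (\<Sum>i<n. (s * D $$ (i, i)) * (cv $ i)\<^sup>2)"
    by (simp add: sum_distrib_left mult_ac)
  also have "\<dots> \<le> 0"
    by (intro sum_nonpos) (auto simp: cv_def J_def mult_nonpos_nonneg not_less)
  finally have "\<not> (\<exists>v\<in>set vs. x v \<noteq> 0)" using pos[OF gx] by fastforce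
  \<comment> \<open>\<open>U\<close> is orthogonal, hence injective, so a vanishing combination has
    vanishing coefficients, contrary to the choice of \<open>c\<close>.\<close>
  hence "y = 0\<^sub>v n" using vs y xy by (intro eq_vecI) auto
  moreover have "U\<^sup>T *\<^sub>v y = cv"
    unfolding y_def using assoc_mult_mat_vec[of "U\<^sup>T" n n U n cv] U UU cv by simp
  ultimately have "cv = 0\<^sub>v n" using U by (auto intro: eq_vecI)
  moreover obtain j where "j \<in> J" "c j \<noteq> 0" using c(1) by blast
  ultimately show False by (auto simp: cv_def J_def dest!: arg_cong[where f = "\<lambda>v. v $ j"])
qed

lemma pair_graphE:
  assumes "pair_graph H"
  shows "finite (pverts H)" "finite (parcs H)" "parcs H \<subseteq> pverts H \<times> pverts H"
    "(u, v) \<in> parcs H \<Longrightarrow> (v, u) \<in> parcs H"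
proof -
  interpret pair_graph H by (rule assms)
  show "finite (pverts H)" "finite (parcs H)" by (fact pair_finite_verts pair_finite_arcs)+
  show "parcs H \<subseteq> pverts H \<times> pverts H" by (auto dest: arc_fst_in_verts arc_snd_in_verts)
  show "(u, v) \<in> parcs H \<Longrightarrow> (v, u) \<in> parcs H" by (rule arcs_symmetric)
qed

text \<open>The forms in \<open>F\<close> leave at most \<open>r\<close> eigenvalues that are not
  positive, those in \<open>G\<close> at most \<open>p\<close> that are not negative. As
  \<open>p + r\<close> is the number of all eigenvalues, both bounds are attained and 0 is not an
  eigenvalue.\<close>

theorem pair_graph_inertia:
  fixes H :: "'a pair_pre_digraph"
  defines "q \<equiv> \<lambda>x :: 'a \<Rightarrow> real. \<Sum>(u, v)\<in>parcs H. x u * x v"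
  assumes H: "pair_graph H"
    and F: "finite F" "\<And>g. g \<in> F \<Longrightarrow> linear_form g"
    and G: "finite G" "\<And>g. g \<in> G \<Longrightarrow> linear_form g"
    and pos: "\<And>x. (\<And>g. g \<in> F \<Longrightarrow> g x = 0) \<Longrightarrow> \<exists>v\<in>pverts H. x v \<noteq> 0 \<Longrightarrow> 0 < q x"
    and neg: "\<And>x. (\<And>g. g \<in> G \<Longrightarrow> g x = 0) \<Longrightarrow> \<exists>v\<in>pverts H. x v \<noteq> 0 \<Longrightarrow> q x < 0"
    and card: "card F \<le> r" "card G \<le> p" "p + r = card (pverts H)"
  shows "n_pos H = p" "n_neg H = r"
proof -
  note fin = pair_graphE(1)[OF H] and arcs = pair_graphE(3)[OF H] and arcs_sym = pair_graphE(4)[OF H]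
  define vs where "vs = (SOME vs. distinct vs \<and> set vs = pverts H)"
  have vs: "distinct vs" "set vs = pverts H"
  proof -
    have "\<exists>vs. distinct vs \<and> set vs = pverts H" using finite_distinct_list[OF fin] by blast
    from someI_ex[OF this] show "distinct vs" "set vs = pverts H" by (simp_all add: vs_def)
  qed
  define n where "n = length vs"
  define A where "A = adj_mat_wrt H vs"
  have A_eq: "adj_mat H = A" by (simp add: adj_mat_def A_def vs_def)
  have A: "A \<in> carrier_mat n n" by (simp add: A_def adj_mat_wrt_def n_def)
  have Aij: "A $$ (i, j) = (if (vs ! i, vs ! j) \<in> parcs H then 1 else 0)" if "i < n" "j < n" for i j
    using that by (simp add: A_def adj_mat_wrt_def n_def)
  have sym: "A\<^sup>T = A"
    using A by (intro eq_matI) (auto simp: Aij intro: arcs_sym)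
  obtain U D where UD: "U \<in> carrier_mat n n" "D \<in> carrier_mat n n" "diagonal_mat D"
    "U\<^sup>T * U = 1\<^sub>m n" "A = U * D * U\<^sup>T"
    using real_symmetric_mat_diagonalization[OF A sym] by blast
  define d where "d i = D $$ (i, i)" for i
  \<comment> \<open>Since \<open>U\<close> is orthogonal, its transpose is its inverse; the
    characteristic polynomial then splits over the diagonal of \<open>D\<close>.\<close>
  have "similar_mat A D"
    unfolding similar_mat_def similar_mat_wit_def
    using UD A mat_mult_left_right_inverse[of "U\<^sup>T" n U]
    by (intro exI[of _ U] exI[of _ "U\<^sup>T"]) (auto simp: Let_def)
  hence "char_poly A = char_poly D" by (rule char_poly_similar)
  also have "\<dots> = (\<Prod>i\<leftarrow>[0..<n]. [:- d i, 1:])"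
    using UD(2,3) by (subst char_poly_upper_triangular[of _ n])
      (auto simp: diag_mat_def diagonal_mat_def upper_triangular_def d_def o_def)
  finally have cp: "char_poly A = (\<Prod>i\<leftarrow>[0..<n]. [:- d i, 1:])" .
  have count: "(\<Sum>x | eigenvalue A x \<and> P x. order x (char_poly A)) = card {i. i < n \<and> P (d i)}" for P
    unfolding eigenvalue_root_char_poly[OF A] by (rule sum_order_prod_linear[OF cp])
  have qx: "q x = (\<Sum>i<n. \<Sum>j<n. A $$ (i, j) * x (vs ! i) * x (vs ! j))" for x
  proof -
    have bij: "bij_betw ((!) vs) {..<n} (pverts H)"
      using vs by (auto simp: n_def intro: bij_betw_nth)
    have "q x = (\<Sum>(u, v)\<in>pverts H \<times> pverts H. if (u, v) \<in> parcs H then x u * x v else 0)"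
      unfolding q_def using fin
      by (intro sum.mono_neutral_cong_left) (use arcs in auto)
    also have "\<dots> = (\<Sum>u\<in>pverts H. \<Sum>v\<in>pverts H. if (u, v) \<in> parcs H then x u * x v else 0)"
      by (simp add: sum.cartesian_product)
    also have "\<dots> = (\<Sum>i<n. \<Sum>j<n. if (vs ! i, vs ! j) \<in> parcs H then x (vs ! i) * x (vs ! j) else 0)"
      by (simp add: sum.reindex_bij_betw[OF bij, symmetric])
    finally show ?thesis by (auto simp: Aij intro!: sum.cong)
  qed
  have cardV: "card (pverts H) = n" using vs distinct_card by (fastforce simp: n_def)
  have n_pos: "n_pos H = card {i. i < n \<and> d i > 0}"
    unfolding n_pos_def A_eq by (rule count)
  have n_neg: "n_neg H = card {i. i < n \<and> d i < 0}"
    unfolding n_neg_def A_eq by (rule count)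
  note bound = card_nonpos_diagonal_le[OF UD vs(1) n_def[symmetric]]
  have "card {i. i < n \<and> \<not> 0 < 1 * D $$ (i, i)} \<le> card F"
    by (rule bound) (use F pos vs qx in auto)
  hence 1: "card {i. i < n \<and> \<not> 0 < d i} \<le> card F" by (simp add: d_def)
  have "card {i. i < n \<and> \<not> 0 < (- 1) * D $$ (i, i)} \<le> card G"
    by (rule bound) (use G neg vs qx in auto)
  hence 2: "card {i. i < n \<and> \<not> d i < 0} \<le> card G" by (simp add: d_def)
  have part: "card {i. i < n \<and> P i} + card {i. i < n \<and> \<not> P i} = n" for P
  proof -
    have "card ({i. i < n \<and> P i} \<union> {i. i < n \<and> \<not> P i}) = card {i. i < n \<and> P i} + card {i. i < n \<and> \<not> P i}"
      by (rule card_Un_disjoint) auto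
    moreover have "{i. i < n \<and> P i} \<union> {i. i < n \<and> \<not> P i} = {..<n}" by auto
    ultimately show ?thesis by simp
  qed
  have 3: "n_pos H \<le> card {i. i < n \<and> \<not> d i < 0}" "n_neg H \<le> card {i. i < n \<and> \<not> 0 < d i}"
    unfolding n_pos n_neg by (auto intro!: card_mono)
  show "n_pos H = p" "n_neg H = r"
    using 1 2 3 card part[of "\<lambda>i. 0 < d i"] part[of "\<lambda>i. d i < 0"]
    unfolding cardV n_pos n_neg by linarith+
qed

section \<open>The adjacency form of a line graph\<close>

lemma finite_edges:
  assumes "finite (parcs G)"
  shows "finite (edges G)"
proof -
  have "edges G = (\<lambda>(u, v). {u, v}) ` parcs G" by (auto simp: edges_def)
  thus ?thesis using assms by simp
qed

text \<open>In the expanded squares the product \<open>x e * x f\<close> occurs once for each common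
  endpoint: twice if \<open>e = f\<close>, once if \<open>e\<close> and \<open>f\<close> are
  adjacent in the line graph, otherwise never. In matrix terms, the Gram matrix of the incidence
  columns is the adjacency matrix plus twice the identity.\<close>

lemma line_graph_quadratic_form:
  fixes x :: "'a set \<Rightarrow> real"
  assumes fin: "finite (pverts G)" "finite (parcs G)" and arcs: "parcs G \<subseteq> pverts G \<times> pverts G"
    and loops: "\<And>u. (u, u) \<notin> parcs G"
  shows "(\<Sum>(e, f)\<in>parcs (line_graph G). x e * x f)
    = (\<Sum>v\<in>pverts G. (\<Sum>e | e \<in> edges G \<and> v \<in> e. x e)\<^sup>2) - 2 * (\<Sum>e\<in>edges G. (x e)\<^sup>2)"
proof -
  define E where "E = edges G"
  have E: "finite E" using finite_edges[OF fin(2)] by (simp add: E_def)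
  have edge: "e \<subseteq> pverts G" "card e = 2" if e: "e \<in> E" for e
  proof -
    obtain u v where "(u, v) \<in> parcs G" "e = {u, v}" using e by (auto simp: E_def edges_def)
    moreover from this have "u \<noteq> v" using loops by auto
    ultimately show "e \<subseteq> pverts G" "card e = 2" using arcs by auto
  qed
  have "(\<Sum>v\<in>pverts G. (\<Sum>e | e \<in> E \<and> v \<in> e. x e)\<^sup>2)
      = (\<Sum>v\<in>pverts G. \<Sum>e\<in>E. \<Sum>f\<in>E. if v \<in> e \<inter> f then x e * x f else 0)"
  proof (intro sum.cong refl)
    fix v
    have "(\<Sum>e | e \<in> E \<and> v \<in> e. x e) = (\<Sum>e\<in>E. if v \<in> e then x e else 0)"
      using E by (simp add: sum.inter_filter)
    thus "(\<Sum>e | e \<in> E \<and> v \<in> e. x e)\<^sup>2 = (\<Sum>e\<in>E. \<Sum>f\<in>E. if v \<in> e \<inter> f then x e * x f else 0)"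
      by (auto simp: power2_eq_square sum_product intro!: sum.cong)
  qed
  also have "\<dots> = (\<Sum>e\<in>E. \<Sum>v\<in>pverts G. \<Sum>f\<in>E. if v \<in> e \<inter> f then x e * x f else 0)"
    by (rule sum.swap)
  also have "\<dots> = (\<Sum>e\<in>E. \<Sum>f\<in>E. \<Sum>v\<in>pverts G. if v \<in> e \<inter> f then x e * x f else 0)"
    by (intro sum.cong refl sum.swap)
  also have "\<dots> = (\<Sum>e\<in>E. \<Sum>f\<in>E. real (card (e \<inter> f)) * (x e * x f))"
  proof (intro sum.cong refl)
    fix e f assume "e \<in> E" "f \<in> E"
    hence "{v \<in> pverts G. v \<in> e \<inter> f} = e \<inter> f" using edge by auto
    thus "(\<Sum>v\<in>pverts G. if v \<in> e \<inter> f then x e * x f else 0) = real (card (e \<inter> f)) * (x e * x f)"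
      using fin(1) by (simp add: sum.inter_filter[symmetric])
  qed
  also have "\<dots> = (\<Sum>e\<in>E. \<Sum>f\<in>E. (if (e, f) \<in> parcs (line_graph G) then x e * x f else 0)
      + (if f = e then 2 * (x e)\<^sup>2 else 0))"
  proof (intro sum.cong refl)
    fix e f assume ef: "e \<in> E" "f \<in> E"
    have "card (e \<inter> f) = 1" if "e \<noteq> f" "e \<inter> f \<noteq> {}"
    proof -
      have "finite e" "finite f" using edge ef by (metis card.infinite zero_neq_numeral)+
      moreover have "e \<inter> f \<noteq> e" using edge(2)[OF ef(1)] edge(2)[OF ef(2)] that \<open>finite f\<close>
        by (metis card_subset_eq inf.cobounded2)
      ultimately have "card (e \<inter> f) < 2" using edge(2)[OF ef(1)]
        by (metis inf.cobounded1 psubsetI psubset_card_mono)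
      moreover have "card (e \<inter> f) > 0" using that \<open>finite e\<close> by (simp add: card_gt_0_iff)
      ultimately show ?thesis by simp
    qed
    thus "real (card (e \<inter> f)) * (x e * x f) = (if (e, f) \<in> parcs (line_graph G) then x e * x f else 0)
      + (if f = e then 2 * (x e)\<^sup>2 else 0)"
      using ef edge(2)[OF ef(1)] by (auto simp: line_graph_def E_def power2_eq_square)
  qed
  also have "\<dots> = (\<Sum>e\<in>E. \<Sum>f\<in>E. if (e, f) \<in> parcs (line_graph G) then x e * x f else 0)
      + 2 * (\<Sum>e\<in>E. (x e)\<^sup>2)"
    using E by (simp add: sum.distrib sum_distrib_left)
  also have "(\<Sum>e\<in>E. \<Sum>f\<in>E. if (e, f) \<in> parcs (line_graph G) then x e * x f else 0)
      = (\<Sum>(e, f)\<in>E \<times> E. if (e, f) \<in> parcs (line_graph G) then x e * x f else 0)"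
    by (simp add: sum.cartesian_product)
  also have "\<dots> = (\<Sum>(e, f)\<in>parcs (line_graph G). x e * x f)"
  proof (rule sum.mono_neutral_cong_right)
    show "parcs (line_graph G) \<subseteq> E \<times> E" by (auto simp: line_graph_def E_def)
  qed (use E in auto)
  finally show ?thesis by (simp add: E_def)
qed

text \<open>Double counting of incident pairs: summing \<open>x\<close> at vertices and summing
  \<open>z\<close> over the ends of edges are adjoint operations.\<close>

lemma sum_incidence:
  fixes x :: "'a set \<Rightarrow> real"
  assumes "finite (pverts G)" "finite (parcs G)" "parcs G \<subseteq> pverts G \<times> pverts G"
  shows "(\<Sum>v\<in>pverts G. (\<Sum>e | e \<in> edges G \<and> v \<in> e. x e) * z v)
    = (\<Sum>e\<in>edges G. x e * (\<Sum>v\<in>e. z v))"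
proof -
  note E = finite_edges[OF assms(2)]
  have sub: "e \<subseteq> pverts G" if "e \<in> edges G" for e
    using that assms(3) by (auto simp: edges_def)
  have "(\<Sum>v\<in>pverts G. (\<Sum>e | e \<in> edges G \<and> v \<in> e. x e) * z v)
      = (\<Sum>v\<in>pverts G. \<Sum>e\<in>edges G. if v \<in> e then x e * z v else 0)"
    using E by (auto simp: sum.inter_filter sum_distrib_right intro!: sum.cong)
  also have "\<dots> = (\<Sum>e\<in>edges G. \<Sum>v\<in>pverts G. if v \<in> e then x e * z v else 0)"
    by (rule sum.swap)
  also have "\<dots> = (\<Sum>e\<in>edges G. x e * (\<Sum>v\<in>e. z v))"
  proof (intro sum.cong refl)
    fix e assume "e \<in> edges G"
    hence "{v \<in> pverts G. v \<in> e} = e" using sub by auto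
    thus "(\<Sum>v\<in>pverts G. if v \<in> e then x e * z v else 0) = x e * (\<Sum>v\<in>e. z v)"
      using assms(1) by (simp add: sum.inter_filter[symmetric] sum_distrib_left)
  qed
  finally show ?thesis .
qed

text \<open>With \<open>y\<close> the vertex sums of \<open>x\<close>, this is
  \<open>|y|^2 \<ge> 2 (y, z) - |z|^2\<close> combined with adjointness. The vector \<open>z\<close>
  is free, so a blockwise candidate for \<open>y\<close> can be inserted; equality holds at
  \<open>z = y\<close>.\<close>

lemma line_graph_quadratic_form_ge:
  fixes x :: "'a set \<Rightarrow> real"
  assumes G: "finite (pverts G)" "finite (parcs G)" "parcs G \<subseteq> pverts G \<times> pverts G"
    "\<And>u. (u, u) \<notin> parcs G"
  shows "(\<Sum>(e, f)\<in>parcs (line_graph G). x e * x f)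
    \<ge> (\<Sum>e\<in>edges G. 2 * x e * (\<Sum>v\<in>e. z v) - 2 * (x e)\<^sup>2) - (\<Sum>v\<in>pverts G. (z v)\<^sup>2)"
proof -
  define y where "y v = (\<Sum>e | e \<in> edges G \<and> v \<in> e. x e)" for v
  have "0 \<le> (\<Sum>v\<in>pverts G. (y v - z v)\<^sup>2)" by (intro sum_nonneg) auto
  also have "\<dots> = (\<Sum>v\<in>pverts G. (y v)\<^sup>2) + (\<Sum>v\<in>pverts G. (z v)\<^sup>2) - 2 * (\<Sum>v\<in>pverts G. y v * z v)"
    by (simp add: power2_diff sum.distrib sum_subtractf sum_distrib_left mult_ac)
  also have "(\<Sum>v\<in>pverts G. y v * z v) = (\<Sum>e\<in>edges G. x e * (\<Sum>v\<in>e. z v))"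
    unfolding y_def by (rule sum_incidence[OF G(1-3)])
  finally show ?thesis unfolding line_graph_quadratic_form[OF G] y_def[symmetric]
    by (simp only: sum_subtractf sum_distrib_left[symmetric] mult.assoc)
qed

text \<open>Adjointness with \<open>z = y\<close> rewrites \<open>|y|^2\<close> as the sum of
  \<open>x e\<close> times the sum of \<open>y\<close> over \<open>e\<close>, after which the square
  in \<open>x e\<close> is completed. The sum over edges of the squared end sums is the form of
  \<open>A + D\<close>.\<close>

lemma line_graph_quadratic_form_eq:
  fixes x :: "'a set \<Rightarrow> real"
  assumes G: "finite (pverts G)" "finite (parcs G)" "parcs G \<subseteq> pverts G \<times> pverts G"
    "\<And>u. (u, u) \<notin> parcs G"
  defines "y \<equiv> \<lambda>v. \<Sum>e | e \<in> edges G \<and> v \<in> e. x e"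
  shows "(\<Sum>(e, f)\<in>parcs (line_graph G). x e * x f)
    = ((\<Sum>e\<in>edges G. (\<Sum>v\<in>e. y v)\<^sup>2) - 2 * (\<Sum>v\<in>pverts G. (y v)\<^sup>2)) / 2
      - 2 * (\<Sum>e\<in>edges G. (x e - (\<Sum>v\<in>e. y v) / 2)\<^sup>2)"
proof -
  have "(\<Sum>v\<in>pverts G. (y v)\<^sup>2) = (\<Sum>e\<in>edges G. x e * (\<Sum>v\<in>e. y v))"
    unfolding power2_eq_square by (subst (1) y_def) (rule sum_incidence[OF G(1-3)])
  moreover have "(\<Sum>e\<in>edges G. (x e - (\<Sum>v\<in>e. y v) / 2)\<^sup>2)
      = (\<Sum>e\<in>edges G. (x e)\<^sup>2 - x e * (\<Sum>v\<in>e. y v) + 1 / 4 * (\<Sum>v\<in>e. y v)\<^sup>2)"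
    by (intro sum.cong refl) (simp add: power2_eq_square field_simps)
  moreover have "\<dots> = (\<Sum>e\<in>edges G. (x e)\<^sup>2) - (\<Sum>e\<in>edges G. x e * (\<Sum>v\<in>e. y v))
      + 1 / 4 * (\<Sum>e\<in>edges G. (\<Sum>v\<in>e. y v)\<^sup>2)"
    by (simp only: sum.distrib sum_subtractf sum_distrib_left)
  moreover have "(\<Sum>e | e \<in> edges G \<and> v \<in> e. x e) = y v" for v by (simp add: y_def)
  ultimately show ?thesis
    unfolding line_graph_quadratic_form[OF G(1-4)] by (simp add: field_simps)
qed

text \<open>Moving to a smaller neighbour again and again must end at 0.\<close>

lemma connected_if_smaller_neighbour:
  fixes G :: "nat pair_pre_digraph"
  assumes zero: "0 \<in> pverts G" and sub: "parcs G \<subseteq> pverts G \<times> pverts G"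
    and nb: "\<And>v. v \<in> pverts G \<Longrightarrow> v > 0 \<Longrightarrow> \<exists>u<v. (u, v) \<in> parcs G"
  shows "connected (with_proj G)"
proof -
  \<comment> \<open>Connectivity means strong connectivity of the symmetric closure, so paths to and
    from 0 are tracked together.\<close>
  define S where "S = mk_symmetric (with_proj G)"
  have S: "pverts S = pverts G" "parcs S = parcs G \<union> (parcs G)\<inverse>"
    by (auto simp: S_def mk_symmetric_def)
  have reach: "v \<in> pverts G \<Longrightarrow> (0, v) \<in> rtrancl_on (pverts S) (parcs S)
      \<and> (v, 0) \<in> rtrancl_on (pverts S) (parcs S)" for v
  proof (induction v rule: less_induct)
    case (less v)
    show ?case
    proof (cases "v = 0")
      case True
      thus ?thesis using zero S by (auto intro: rtrancl_on.intros)
    next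
      case False
      then obtain u where u: "u < v" "(u, v) \<in> parcs G" using nb less.prems by blast
      hence uv: "u \<in> pverts S" "v \<in> pverts S" "(u, v) \<in> parcs S" "(v, u) \<in> parcs S"
        using sub S by auto
      with less.IH[OF u(1)] S show ?thesis
        by (auto intro: rtrancl_on_into_rtrancl_on converse_rtrancl_on_into_rtrancl_on)
    qed
  qed
  have "strongly_connected (with_proj S)"
    unfolding strongly_connected_def reachable_def
    using zero S reach by (auto intro: rtrancl_on_trans)
  thus ?thesis by (simp add: connected_def S_def)
qed

section \<open>Chains of blocks\<close>

text \<open>
  The building block has a 4-cycle \<open>0 1 2 3\<close> and two pentagons \<open>4 5 6 7 8\<close> and
  \<open>9 10 11 12 13\<close>, the first joined to \<open>0\<close> and the second to \<open>1\<close>; consecutive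
  blocks are joined at their vertices \<open>0\<close>.
\<close>

definition block :: "(nat \<times> nat) set" where
  "block = {(0, 1), (1, 2), (2, 3), (0, 3),
            (0, 4), (4, 5), (5, 6), (6, 7), (7, 8), (4, 8),
            (1, 9), (9, 10), (10, 11), (11, 12), (12, 13), (9, 13)}"

text \<open>Vertex \<open>j\<close> of copy \<open>i\<close> is encoded as
  \<open>14 * i + j\<close>. Every undirected edge is listed once, smaller end first;
  \<open>k\<close> copies need \<open>k - 1\<close> links.\<close>

definition chain_arcs :: "nat \<Rightarrow> (nat \<times> nat) set" where
  "chain_arcs k = (\<lambda>(i, a, b). (14 * i + a, 14 * i + b)) ` ({..<k} \<times> block)
     \<union> (\<lambda>i. (14 * i, 14 * i + 14)) ` {..<k - 1}"

definition chain :: "nat \<Rightarrow> nat pair_pre_digraph" where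
  "chain k = \<lparr>pverts = {..<14 * k}, parcs = chain_arcs k \<union> (chain_arcs k)\<inverse>\<rparr>"

lemma finite_block: "finite block" and card_block: "card block = 16"
  by (simp_all add: block_def)

lemma block_less:
  assumes "(a, b) \<in> block"
  shows "a < b" "b < 14"
  using assms by (auto simp: block_def)

lemma sum_block:
  "(\<Sum>p\<in>block. f p) = f (0, 1) + f (1, 2) + f (2, 3) + f (0, 3)
    + f (0, 4) + f (4, 5) + f (5, 6) + f (6, 7) + f (7, 8) + f (4, 8)
    + f (1, 9) + f (9, 10) + f (10, 11) + f (11, 12) + f (12, 13) + (f (9, 13) :: real)"
  by (simp add: block_def)

lemma sum_14:
  "(\<Sum>j<14::nat. f j) = f 0 + f 1 + f 2 + f 3 + f 4 + f 5 + f 6 + f 7 + f 8 + f 9 + f 10 + f 11 + f 12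
    + (f 13 :: real)"
  by (simp add: eval_nat_numeral)

lemma less_14_cases:
  "j < (14::nat) \<Longrightarrow> j \<in> {0, 1, 2, 3, 4, 5, 6, 7, 8, 9, 10, 11, 12, 13}"
  by (simp, arith)

section \<open>Definite subspaces for a single block\<close>

text \<open>Here \<open>p\<close> stands for the vertex sums and \<open>Q\<close> for the form of
  \<open>M\<close>. The nine equations leave the coordinates \<open>p 2\<close>, \<open>p 5\<close>,
  \<open>p 7\<close>, \<open>p 10\<close>, \<open>p 12\<close>, in which \<open>Q\<close> is minus a
  sum of squares. The condition \<open>p 0 = 0\<close> later silences the linking edges.\<close>

lemma block_negative:
  fixes p :: "nat \<Rightarrow> real"
  assumes "p 0 = 0" "p 1 = 0" "p 4 = 0" "p 9 = 0" "p 2 + p 3 = 0"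
    "p 5 + p 6 = 0" "p 7 + p 8 = 0" "p 10 + p 11 = 0" "p 12 + p 13 = 0"
  defines "Q \<equiv> (\<Sum>(a, b)\<in>block. (p a + p b)\<^sup>2) - 2 * (\<Sum>j<14. (p j)\<^sup>2)"
  shows "Q \<le> 0" "Q = 0 \<Longrightarrow> j < 14 \<Longrightarrow> p j = 0"
proof -
  have p: "p 3 = - p 2" "p 6 = - p 5" "p 8 = - p 7" "p 11 = - p 10" "p 13 = - p 12"
    using assms by linarith+
  have Q: "Q = - (2 * (p 2)\<^sup>2 + (p 5)\<^sup>2 + (p 7)\<^sup>2 + (p 5 + p 7)\<^sup>2 + (p 10)\<^sup>2 + (p 12)\<^sup>2 + (p 10 + p 12)\<^sup>2)"
    unfolding Q_def sum_block sum_14 using assms(1-4)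
    by (simp add: p) (simp add: power2_eq_square algebra_simps)
  show "Q \<le> 0" unfolding Q neg_le_0_iff_le by (intro add_nonneg_nonneg) auto
  assume "Q = 0"
  hence "p 2 = 0 \<and> p 5 = 0 \<and> p 7 = 0 \<and> p 10 = 0 \<and> p 12 = 0"
    unfolding Q neg_equal_0_iff_equal by (simp add: add_nonneg_eq_0_iff)
  thus "j < 14 \<Longrightarrow> p j = 0"
    using p assms(1-4) less_14_cases[of j] by auto
qed

text \<open>The vertex sums of an edge weighting within one block, linking edges left out.\<close>

definition edge_boundary :: "(nat \<times> nat \<Rightarrow> real) \<Rightarrow> nat \<Rightarrow> real" where
  "edge_boundary X j = (\<Sum>(a, b)\<in>block. if j = a \<or> j = b then X (a, b) else 0)"

lemma sum_edge_boundary: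
  "(\<Sum>j<14. edge_boundary X j * z j) = (\<Sum>(a, b)\<in>block. X (a, b) * (z a + z b))"
proof -
  have "(\<Sum>j<14. edge_boundary X j * z j)
      = (\<Sum>j<14. \<Sum>(a, b)\<in>block. if j = a \<or> j = b then X (a, b) * z j else 0)"
    unfolding edge_boundary_def sum_distrib_right by (intro sum.cong refl) auto
  also have "\<dots> = (\<Sum>(a, b)\<in>block. \<Sum>j<14. if j = a \<or> j = b then X (a, b) * z j else 0)"
    unfolding case_prod_unfold by (rule sum.swap)
  also have "\<dots> = (\<Sum>(a, b)\<in>block. X (a, b) * (z a + z b))"
  proof (intro sum.cong refl, clarify)
    fix a b assume ab: "(a, b) \<in> block"
    \<comment> \<open>Because \<open>a < b < 14\<close>, the index \<open>j\<close> meets each end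
      exactly once and the two cases exclude each other.\<close>
    have "(\<Sum>j<14. if j = a \<or> j = b then X (a, b) * z j else 0)
        = (\<Sum>j<14. (if j = a then X (a, b) * z a else 0) + (if j = b then X (a, b) * z b else 0))"
      using block_less[OF ab] by (intro sum.cong refl) auto
    thus "(\<Sum>j<14. if j = a \<or> j = b then X (a, b) * z j else 0) = X (a, b) * (z a + z b)"
      using block_less[OF ab] by (simp add: sum.distrib distrib_left)
  qed
  finally show ?thesis .
qed

text \<open>Of 16 edge weights the seven equations leave nine free, and in these \<open>Q\<close> is
  a positive combination of the squares of nine independent linear forms. \<open>Q\<close> is
  written in the shape of the bound in \<open>line_graph_quadratic_form_ge\<close>, with the
  boundary in place of \<open>z\<close>.\<close>

lemma block_positive:
  fixes X :: "nat \<times> nat \<Rightarrow> real"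
  assumes eqs: "X (5, 6) = X (4, 5) + X (6, 7)" "X (7, 8) = X (6, 7) + X (4, 8)"
    "X (10, 11) = X (9, 10) + X (11, 12)" "X (12, 13) = X (11, 12) + X (9, 13)"
    "X (0, 1) = X (0, 4) + X (1, 9)" "X (2, 3) = 2 * (X (1, 2) + X (0, 3))"
    "2 * (X (0, 4) - X (1, 9)) = X (0, 3) - X (1, 2)"
  defines "Q \<equiv> (\<Sum>(a, b)\<in>block. 2 * X (a, b) * (edge_boundary X a + edge_boundary X b) - 2 * (X (a, b))\<^sup>2)
      - (\<Sum>j<14. (edge_boundary X j)\<^sup>2)"
  shows "Q \<ge> 0" "Q = 0 \<Longrightarrow> (a, b) \<in> block \<Longrightarrow> X (a, b) = 0"
proof -
  have B: "edge_boundary X 0 = X (0, 1) + X (0, 3) + X (0, 4)"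
    "edge_boundary X 1 = X (0, 1) + X (1, 2) + X (1, 9)"
    "edge_boundary X 2 = X (1, 2) + X (2, 3)"
    "edge_boundary X 3 = X (2, 3) + X (0, 3)"
    "edge_boundary X 4 = X (0, 4) + X (4, 5) + X (4, 8)"
    "edge_boundary X 5 = X (4, 5) + X (5, 6)"
    "edge_boundary X 6 = X (5, 6) + X (6, 7)"
    "edge_boundary X 7 = X (6, 7) + X (7, 8)"
    "edge_boundary X 8 = X (7, 8) + X (4, 8)"
    "edge_boundary X 9 = X (1, 9) + X (9, 10) + X (9, 13)"
    "edge_boundary X 10 = X (9, 10) + X (10, 11)"
    "edge_boundary X 11 = X (10, 11) + X (11, 12)"
    "edge_boundary X 12 = X (11, 12) + X (12, 13)"
    "edge_boundary X 13 = X (12, 13) + X (9, 13)"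
    unfolding edge_boundary_def sum_block by simp_all
  define f g s e0 e2 e4 h0 h2 h4
    where vars: "f = X (0, 4)" "g = X (1, 9)" "s = X (1, 2)" "e0 = X (4, 5)" "e2 = X (6, 7)"
      "e4 = X (4, 8)" "h0 = X (9, 10)" "h2 = X (11, 12)" "h4 = X (9, 13)"
  have w: "X (0, 3) = s + 2 * f - 2 * g" using eqs(7) vars by simp
  have X: "X (5, 6) = e0 + e2" "X (7, 8) = e2 + e4" "X (10, 11) = h0 + h2" "X (12, 13) = h2 + h4"
    "X (0, 1) = f + g" "X (2, 3) = 4 * (s + f - g)"
    using eqs w vars by simp_all
  have "Q = (\<Sum>(a, b)\<in>block. 2 * (X (a, b) * (edge_boundary X a + edge_boundary X b))
      - 2 * (X (a, b))\<^sup>2) - (\<Sum>j<14. edge_boundary X j * edge_boundary X j)"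
    by (simp add: Q_def power2_eq_square mult.assoc)
  \<comment> \<open>Adjointness turns the cross term into twice the squared norm of the
    boundary.\<close>
  also have "\<dots> = (\<Sum>j<14. (edge_boundary X j)\<^sup>2) - 2 * (\<Sum>(a, b)\<in>block. (X (a, b))\<^sup>2)"
    using sum_edge_boundary[of X "edge_boundary X"]
    by (simp add: case_prod_unfold sum_subtractf sum_distrib_left[symmetric] power2_eq_square)
  \<comment> \<open>The first two rows come from the pentagons, up to the terms \<open>f^2\<close>
    and \<open>g^2\<close>; these join the 4-cycle and the two edges attaching the pentagons to give
    the last row.\<close>
  also have "\<dots> = (e0 + e4 + 2 * e2)\<^sup>2 + (e0 + f)\<^sup>2 + (e4 + f)\<^sup>2
      + (h0 + h4 + 2 * h2)\<^sup>2 + (h0 + g)\<^sup>2 + (h4 + g)\<^sup>2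
      + (f + g + 3 * (s + f - g))\<^sup>2 + 7 * (s + f - g)\<^sup>2 + (f - g)\<^sup>2"
    unfolding sum_block sum_14 prod.case B X w vars[symmetric]
    by (simp add: power2_eq_square algebra_simps)
  finally have Q: "Q = (e0 + e4 + 2 * e2)\<^sup>2 + (e0 + f)\<^sup>2 + (e4 + f)\<^sup>2
      + (h0 + h4 + 2 * h2)\<^sup>2 + (h0 + g)\<^sup>2 + (h4 + g)\<^sup>2
      + (f + g + 3 * (s + f - g))\<^sup>2 + 7 * (s + f - g)\<^sup>2 + (f - g)\<^sup>2" .
  show "Q \<ge> 0" unfolding Q by (intro add_nonneg_nonneg) auto
  assume "Q = 0"
  hence "e0 + e4 + 2 * e2 = 0 \<and> e0 + f = 0 \<and> e4 + f = 0 \<and> h0 + h4 + 2 * h2 = 0 \<and> h0 + g = 0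
      \<and> h4 + g = 0 \<and> f + g + 3 * (s + f - g) = 0 \<and> s + f - g = 0 \<and> f - g = 0"
    unfolding Q by (simp only: add_nonneg_eq_0_iff add_nonneg_nonneg zero_le_power2
        zero_le_mult_iff zero_le_numeral mult_eq_0_iff power_eq_0_iff zero_neq_numeral simp_thms HOL.conj_assoc) auto
  hence "f = 0" "g = 0" "s = 0" "e0 = 0" "e2 = 0" "e4 = 0" "h0 = 0" "h2 = 0" "h4 = 0"
    by auto
  thus "(a, b) \<in> block \<Longrightarrow> X (a, b) = 0"
    using w X vars by (auto simp: block_def)
qed

section \<open>The chain as a connected graph, and sums over its edges and vertices\<close>

lemma chain_arcs_less:
  assumes "(u, v) \<in> chain_arcs k"
  shows "u < v" "v < 14 * k"
proof -
  have "u < v \<and> v < 14 * k"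
    using assms unfolding chain_arcs_def
  proof (elim UnE imageE)
    fix t assume t: "(u, v) = (case t of (i, a, b) \<Rightarrow> (14 * i + a, 14 * i + b))" "t \<in> {..<k} \<times> block"
    obtain i a b where "t = (i, a, b)" by (cases t)
    with t block_less[of a b] show ?thesis by auto
  next
    fix i assume "(u, v) = (14 * i, 14 * i + 14)" "i \<in> {..<k - 1}"
    thus ?thesis by auto
  qed
  thus "u < v" "v < 14 * k" by auto
qed

lemma finite_chain_arcs: "finite (chain_arcs k)"
  by (simp add: chain_arcs_def finite_block)

lemma chain_simps:
  "pverts (chain k) = {..<14 * k}"
  "parcs (chain k) = chain_arcs k \<union> (chain_arcs k)\<inverse>"
  by (simp_all add: chain_def)

lemma chain_wf:
  "finite (pverts (chain k))" "finite (parcs (chain k))"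
  "parcs (chain k) \<subseteq> pverts (chain k) \<times> pverts (chain k)"
  "(u, u) \<notin> parcs (chain k)"
  using chain_arcs_less[of _ _ k] finite_chain_arcs by (force simp: chain_simps)+

lemma pair_graph_chain: "pair_graph (chain k)"
proof unfold_locales
  show "symmetric (with_proj (chain k))"
    by (auto simp: symmetric_def sym_def chain_simps)
qed (use chain_wf(1-3)[of k] chain_wf(4)[of _ k] in \<open>auto simp: chain_simps\<close>)

text \<open>In a block every vertex but 0 has a smaller neighbour; the vertex 0 of a later block is
  linked to the vertex 0 of the block before.\<close>

lemma connected_chain:
  assumes "k \<ge> 1"
  shows "connected (with_proj (chain k))"
proof (rule connected_if_smaller_neighbour)
  show "0 \<in> pverts (chain k)" using assms by (simp add: chain_simps)
  show "parcs (chain k) \<subseteq> pverts (chain k) \<times> pverts (chain k)" by (rule chain_wf)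
  fix v assume v: "v \<in> pverts (chain k)" "v > 0"
  define i j where "i = v div 14" and "j = v mod 14"
  have ij: "v = 14 * i + j" "i < k" "j < 14" using v by (auto simp: i_def j_def chain_simps)
  have "\<exists>u. (u, v) \<in> chain_arcs k"
  proof (cases "j = 0")
    case True
    hence "i > 0" "(14 * (i - 1), 14 * (i - 1) + 14) \<in> chain_arcs k"
      using ij v by (auto simp: chain_arcs_def)
    moreover have "14 * (i - 1) + 14 = v" using True ij \<open>i > 0\<close> by (simp add: algebra_simps)
    ultimately show ?thesis by metis
  next
    case False
    have "\<forall>j\<in>{1, 2, 3, 4, 5, 6, 7, 8, 9, 10, 11, 12, 13}. \<exists>a. (a, j) \<in> block"
      by (simp add: block_def ex_disj_distrib)
    with False less_14_cases[OF ij(3)] obtain a where "(a, j) \<in> block" by blast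
    hence "(14 * i + a, v) \<in> chain_arcs k"
      unfolding chain_arcs_def using ij by (intro UnI1 image_eqI[of _ _ "(i, a, j)"]) auto
    thus ?thesis ..
  qed
  thus "\<exists>u<v. (u, v) \<in> parcs (chain k)"
    using chain_arcs_less by (auto simp: chain_simps)
qed

text \<open>The listing in \<open>chain_arcs\<close> is free of repetitions: the quotient of an end
  by 14 identifies the copy, linking edges have a multiple of 14 as larger end while block edges
  never do, and ordered ends make the passage to unordered pairs injective.\<close>

lemma sum_edges_chain:
  "sum f (edges (chain k)) = (\<Sum>i<k. \<Sum>(a, b)\<in>block. f {14 * i + a, 14 * i + b})
    + (\<Sum>i<k - 1. f {14 * i, 14 * i + 14})"
proof -
  define B where "B = (\<lambda>(i, a, b). (14 * i + a, 14 * i + b)) ` ({..<k} \<times> block)"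
  define J where "J = (\<lambda>i. (14 * i, 14 * i + 14 :: nat)) ` {..<k - 1}"
  have arcs: "chain_arcs k = B \<union> J" by (simp add: chain_arcs_def B_def J_def)
  have inj: "inj_on (\<lambda>(i, a, b). (14 * i + a, 14 * i + b)) ({..<k} \<times> block)"
  proof (rule inj_onI, clarsimp)
    fix i a b i' a' b'
    assume *: "(a, b) \<in> block" "(a', b') \<in> block"
      "14 * i + a = 14 * i' + a'" "14 * i + b = 14 * i' + b'"
    have "a < 14" "a' < 14" using block_less[OF *(1)] block_less[OF *(2)] by auto
    hence "i = i'" using arg_cong[OF *(3), of "\<lambda>n. n div 14"] by simp
    thus "i = i' \<and> a = a' \<and> b = b'" using *(3,4) by simp
  qed
  have disj: "B \<inter> J = {}"
  proof -
    have "14 * i + b \<noteq> 14 * j + 14" if "(a, b) \<in> block" for i j a b :: nat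
    proof
      assume "14 * i + b = 14 * j + 14"
      from arg_cong[OF this, of "\<lambda>n. n mod 14"] show False using block_less[OF that] by simp
    qed
    thus ?thesis unfolding B_def J_def by fastforce
  qed
  have "edges (chain k) = (\<lambda>(u, v). {u, v}) ` chain_arcs k"
    by (auto simp: edges_def chain_simps doubleton_eq_iff)
  moreover have "inj_on (\<lambda>(u, v). {u, v}) (chain_arcs k)"
    by (auto simp: inj_on_def doubleton_eq_iff dest!: chain_arcs_less(1))
  ultimately have "sum f (edges (chain k)) = (\<Sum>(u, v)\<in>chain_arcs k. f {u, v})"
    by (simp add: sum.reindex case_prod_unfold)
  also have "\<dots> = (\<Sum>(u, v)\<in>B. f {u, v}) + (\<Sum>(u, v)\<in>J. f {u, v})"
    unfolding arcs using disj by (intro sum.union_disjoint) (auto simp: B_def J_def finite_block)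
  also have "(\<Sum>(u, v)\<in>B. f {u, v}) = (\<Sum>(i, a, b)\<in>{..<k} \<times> block. f {14 * i + a, 14 * i + b})"
    unfolding B_def by (subst sum.reindex[OF inj]) (simp add: case_prod_unfold o_def)
  also have "\<dots> = (\<Sum>i<k. \<Sum>(a, b)\<in>block. f {14 * i + a, 14 * i + b})"
    by (simp add: sum.cartesian_product case_prod_unfold)
  also have "(\<Sum>(u, v)\<in>J. f {u, v}) = (\<Sum>i<k - 1. f {14 * i, 14 * i + 14})"
    unfolding J_def by (subst sum.reindex) (auto simp: inj_on_def)
  finally show ?thesis .
qed

lemma card_edges_chain:
  assumes "k \<ge> 1"
  shows "card (edges (chain k)) = 17 * k - 1"
proof -
  have "card (edges (chain k)) = (\<Sum>e\<in>edges (chain k). 1)" by simp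
  also have "\<dots> = 16 * k + (k - 1)" unfolding sum_edges_chain by (simp add: card_block)
  finally show ?thesis using assms by simp
qed

lemma sum_vertices_chain:
  fixes f :: "nat \<Rightarrow> real"
  shows "(\<Sum>v<14 * k. f v) = (\<Sum>i<k. \<Sum>j<14. f (14 * i + j))"
proof -
  have "(\<Sum>v<14 * k. f v) = (\<Sum>i<k. sum f {i * 14..<i * 14 + 14})"
    using sum.nat_group[of f 14 k] by (simp add: mult.commute)
  also have "\<dots> = (\<Sum>i<k. \<Sum>j<14. f (14 * i + j))"
  proof (rule sum.cong[OF refl])
    fix i :: nat
    show "sum f {i * 14..<i * 14 + 14} = (\<Sum>j<14. f (14 * i + j))"
      using sum.shift_bounds_nat_ivl[of f 0 "i * 14" 14]
      by (simp add: atLeast0LessThan add.commute mult.commute)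
  qed
  finally show ?thesis .
qed

section \<open>The linear conditions cutting out the definite subspaces\<close>

text \<open>The hypotheses of \<open>block_positive\<close> for copy \<open>i\<close>, each as a
  form required to vanish. The length of a list bounds the number of forms without any proof that
  they differ.\<close>

definition edge_equations :: "nat \<Rightarrow> ((nat set \<Rightarrow> real) \<Rightarrow> real) list" where
  "edge_equations i = (let X = (\<lambda>a b x. x {14 * i + a, 14 * i + b}) in
     [\<lambda>x. X 4 5 x + X 6 7 x - X 5 6 x, \<lambda>x. X 6 7 x + X 4 8 x - X 7 8 x,
      \<lambda>x. X 9 10 x + X 11 12 x - X 10 11 x, \<lambda>x. X 11 12 x + X 9 13 x - X 12 13 x,
      \<lambda>x. X 0 4 x + X 1 9 x - X 0 1 x, \<lambda>x. 2 * (X 1 2 x + X 0 3 x) - X 2 3 x,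
      \<lambda>x. 2 * (X 0 4 x - X 1 9 x) - (X 0 3 x - X 1 2 x)])"

definition edge_forms :: "nat \<Rightarrow> ((nat set \<Rightarrow> real) \<Rightarrow> real) set" where
  "edge_forms k = (\<Union>i<k. set (edge_equations i)) \<union> (\<lambda>i x. x {14 * i, 14 * i + 14}) ` {..<k - 1}"

definition incidence :: "nat \<Rightarrow> nat \<Rightarrow> (nat set \<Rightarrow> real) \<Rightarrow> real" where
  "incidence k v x = (\<Sum>e | e \<in> edges (chain k) \<and> v \<in> e. x e)"

text \<open>The hypotheses of \<open>block_negative\<close>, applied to the full vertex sums, to
  which linking edges contribute.\<close>

definition vertex_equations :: "nat \<Rightarrow> nat \<Rightarrow> ((nat set \<Rightarrow> real) \<Rightarrow> real) list" where
  "vertex_equations k i = (let Y = (\<lambda>j. incidence k (14 * i + j)) in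
     [Y 0, Y 1, Y 4, Y 9, \<lambda>x. Y 2 x + Y 3 x, \<lambda>x. Y 5 x + Y 6 x, \<lambda>x. Y 7 x + Y 8 x,
      \<lambda>x. Y 10 x + Y 11 x, \<lambda>x. Y 12 x + Y 13 x])"

definition vertex_forms :: "nat \<Rightarrow> ((nat set \<Rightarrow> real) \<Rightarrow> real) set" where
  "vertex_forms k = (\<Union>i<k. set (vertex_equations k i))"

lemma linear_form_edge_forms: "g \<in> edge_forms k \<Longrightarrow> linear_form g"
proof -
  have "list_all linear_form (edge_equations i)" for i
    by (simp add: edge_equations_def Let_def linear_form_def algebra_simps)
  moreover have "linear_form (\<lambda>x. x {14 * i, 14 * i + 14})" for i :: nat
    by (simp add: linear_form_def)
  ultimately show "g \<in> edge_forms k \<Longrightarrow> linear_form g"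
    unfolding edge_forms_def list_all_iff by blast
qed

lemma linear_form_vertex_forms: "g \<in> vertex_forms k \<Longrightarrow> linear_form g"
proof -
  have add: "incidence k v (\<lambda>e. x e + y e) = incidence k v x + incidence k v y"
    and mult: "incidence k v (\<lambda>e. c * x e) = c * incidence k v x" for v x y c
    by (simp_all add: incidence_def sum.distrib sum_distrib_left)
  have "list_all linear_form (vertex_equations k i)" for i
    by (simp add: vertex_equations_def Let_def linear_form_def add mult algebra_simps)
  thus "g \<in> vertex_forms k \<Longrightarrow> linear_form g"
    unfolding vertex_forms_def list_all_iff by blast
qed

lemma finite_edge_forms: "finite (edge_forms k)"
  and finite_vertex_forms: "finite (vertex_forms k)"
  by (simp_all add: edge_forms_def vertex_forms_def)

lemma card_edge_forms: "card (edge_forms k) \<le> 7 * k + (k - 1)"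
proof -
  have "card (set (edge_equations i)) \<le> 7" for i
    using card_length[of "edge_equations i"] by (simp add: edge_equations_def Let_def)
  hence "card (\<Union>i<k. set (edge_equations i)) \<le> (\<Sum>i<k. 7)"
    by (intro order.trans[OF card_UN_le] sum_mono) auto
  moreover have "card ((\<lambda>i x :: nat set \<Rightarrow> real. x {14 * i, 14 * i + 14}) ` {..<k - 1}) \<le> card {..<k - 1}"
    by (intro card_image_le) simp
  ultimately show ?thesis
    unfolding edge_forms_def by (intro order.trans[OF card_Un_le]) simp
qed

lemma card_vertex_forms: "card (vertex_forms k) \<le> 9 * k"
proof -
  have "card (set (vertex_equations k i)) \<le> 9" for i
    using card_length[of "vertex_equations k i"] by (simp add: vertex_equations_def Let_def)
  hence "card (\<Union>i<k. set (vertex_equations k i)) \<le> (\<Sum>i<k. 9)"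
    by (intro order.trans[OF card_UN_le] sum_mono) auto
  thus ?thesis by (simp add: vertex_forms_def)
qed

section \<open>Definiteness on the chain and the resulting inertia\<close>

text \<open>As \<open>x\<close> vanishes on the linking edges, the lower bound at a blockwise
  \<open>z\<close> is the sum of the block forms \<open>Q i\<close>. All of them are nonnegative,
  and if all were zero then \<open>x\<close> would vanish on every edge.\<close>

lemma chain_positive:
  assumes zero: "\<And>g. g \<in> edge_forms k \<Longrightarrow> g x = 0"
    and nz: "\<exists>e\<in>edges (chain k). x e \<noteq> 0"
  shows "0 < (\<Sum>(e, f)\<in>parcs (line_graph (chain k)). x e * x f)"
proof -
  define X where "X i = (\<lambda>(a, b). x {14 * i + a, 14 * i + b})" for i
  define Q where "Q i = (\<Sum>(a, b)\<in>block. 2 * X i (a, b) * (edge_boundary (X i) a + edge_boundary (X i) b)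
      - 2 * (X i (a, b))\<^sup>2) - (\<Sum>j<14. (edge_boundary (X i) j)\<^sup>2)" for i
  \<comment> \<open>The quotient by 14 selects the copy and the remainder the vertex in it.\<close>
  define z where "z v = edge_boundary (X (v div 14)) (v mod 14)" for v
  have z: "z (14 * i + j) = edge_boundary (X i) j" if "j < 14" for i j
    using that by (simp add: z_def)
  have join: "x {14 * i, 14 * i + 14} = 0" if "i < k - 1" for i
    using zero[of "\<lambda>x. x {14 * i, 14 * i + 14}"] that by (auto simp: edge_forms_def)
  have eqs: "X i (5, 6) = X i (4, 5) + X i (6, 7)" "X i (7, 8) = X i (6, 7) + X i (4, 8)"
    "X i (10, 11) = X i (9, 10) + X i (11, 12)" "X i (12, 13) = X i (11, 12) + X i (9, 13)"
    "X i (0, 1) = X i (0, 4) + X i (1, 9)" "X i (2, 3) = 2 * (X i (1, 2) + X i (0, 3))"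
    "2 * (X i (0, 4) - X i (1, 9)) = X i (0, 3) - X i (1, 2)" if i: "i < k" for i
  proof -
    have "list_all (\<lambda>g. g x = 0) (edge_equations i)"
      using zero i unfolding edge_forms_def list_all_iff by blast
    thus "X i (5, 6) = X i (4, 5) + X i (6, 7)" "X i (7, 8) = X i (6, 7) + X i (4, 8)"
      "X i (10, 11) = X i (9, 10) + X i (11, 12)" "X i (12, 13) = X i (11, 12) + X i (9, 13)"
      "X i (0, 1) = X i (0, 4) + X i (1, 9)" "X i (2, 3) = 2 * (X i (1, 2) + X i (0, 3))"
      "2 * (X i (0, 4) - X i (1, 9)) = X i (0, 3) - X i (1, 2)"
      by (simp_all add: edge_equations_def X_def)
  qed
  have Q0: "Q i \<ge> 0" if "i < k" for i
    unfolding Q_def by (rule block_positive(1)[OF eqs[OF that]])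
  have "\<exists>i<k. Q i \<noteq> 0"
  proof (rule ccontr)
    assume "\<not> ?thesis"
    hence "X i (a, b) = 0" if "i < k" "(a, b) \<in> block" for i a b
      using block_positive(2)[OF eqs[OF that(1)] _ that(2)] that(1) by (auto simp: Q_def)
    hence "(\<Sum>e\<in>edges (chain k). (x e)\<^sup>2) = 0"
      unfolding sum_edges_chain using join by (auto simp: X_def intro!: sum.neutral)
    thus False using nz finite_edges[OF chain_wf(2)] by (simp add: sum_nonneg_eq_0_iff)
  qed
  then obtain i where i: "i < k" "Q i \<noteq> 0" by blast
  have "0 < (\<Sum>i<k. Q i)" using Q0 i by (intro sum_pos2[of _ i]) (auto simp: less_le)
  also have "(\<Sum>i<k. Q i) = (\<Sum>e\<in>edges (chain k). 2 * x e * (\<Sum>v\<in>e. z v) - 2 * (x e)\<^sup>2)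
      - (\<Sum>v\<in>pverts (chain k). (z v)\<^sup>2)"
  proof -
    have "(\<Sum>e\<in>edges (chain k). 2 * x e * (\<Sum>v\<in>e. z v) - 2 * (x e)\<^sup>2)
        = (\<Sum>i<k. \<Sum>(a, b)\<in>block. 2 * X i (a, b) * (edge_boundary (X i) a + edge_boundary (X i) b)
          - 2 * (X i (a, b))\<^sup>2)"
    proof -
      have "(\<Sum>i<k - 1. 2 * x {14 * i, 14 * i + 14} * sum z {14 * i, 14 * i + 14}
          - 2 * (x {14 * i, 14 * i + 14})\<^sup>2) = 0"
        using join by (intro sum.neutral) auto
      moreover have "2 * x {14 * i + a, 14 * i + b} * sum z {14 * i + a, 14 * i + b}
          - 2 * (x {14 * i + a, 14 * i + b})\<^sup>2
          = 2 * X i (a, b) * (edge_boundary (X i) a + edge_boundary (X i) b) - 2 * (X i (a, b))\<^sup>2"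
        if "(a, b) \<in> block" for i a b
        using block_less[OF that] z[of a i] z[of b i] by (simp add: X_def)
      ultimately show ?thesis
        unfolding sum_edges_chain by (auto intro!: sum.cong)
    qed
    moreover have "(\<Sum>v\<in>pverts (chain k). (z v)\<^sup>2) = (\<Sum>i<k. \<Sum>j<14. (edge_boundary (X i) j)\<^sup>2)"
      unfolding chain_simps sum_vertices_chain by (intro sum.cong refl) (simp add: z)
    ultimately show ?thesis by (simp add: Q_def sum_subtractf)
  qed
  also have "\<dots> \<le> (\<Sum>(e, f)\<in>parcs (line_graph (chain k)). x e * x f)"
    by (rule line_graph_quadratic_form_ge[OF chain_wf])
  finally show ?thesis .
qed

text \<open>The vertex sums vanish at both ends of each linking edge, so the form of
  \<open>M\<close> splits over the blocks, and the whole form is a sum of two nonpositive parts,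
  \<open>(\<Sum>i<k. Q i) / 2\<close> and \<open>- 2 * N\<close>.\<close>

lemma chain_negative:
  assumes zero: "\<And>g. g \<in> vertex_forms k \<Longrightarrow> g x = 0"
    and nz: "\<exists>e\<in>edges (chain k). x e \<noteq> 0"
  shows "(\<Sum>(e, f)\<in>parcs (line_graph (chain k)). x e * x f) < 0"
proof -
  define y where "y v = (\<Sum>e | e \<in> edges (chain k) \<and> v \<in> e. x e)" for v
  define p where "p i j = y (14 * i + j)" for i j
  define Q where "Q i = (\<Sum>(a, b)\<in>block. (p i a + p i b)\<^sup>2) - 2 * (\<Sum>j<14. (p i j)\<^sup>2)" for i
  have eqs: "p i 0 = 0" "p i 1 = 0" "p i 4 = 0" "p i 9 = 0" "p i 2 + p i 3 = 0"
    "p i 5 + p i 6 = 0" "p i 7 + p i 8 = 0" "p i 10 + p i 11 = 0" "p i 12 + p i 13 = 0"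
    if i: "i < k" for i
  proof -
    have "list_all (\<lambda>g. g x = 0) (vertex_equations k i)"
      using zero i unfolding vertex_forms_def list_all_iff by blast
    thus "p i 0 = 0" "p i 1 = 0" "p i 4 = 0" "p i 9 = 0" "p i 2 + p i 3 = 0"
      "p i 5 + p i 6 = 0" "p i 7 + p i 8 = 0" "p i 10 + p i 11 = 0" "p i 12 + p i 13 = 0"
      by (simp_all add: vertex_equations_def p_def y_def incidence_def)
  qed
  have Q0: "Q i \<le> 0" if "i < k" for i
    unfolding Q_def by (rule block_negative(1)[OF eqs[OF that]])
  have join: "y (14 * i) = 0" if "i < k" for i using eqs(1)[OF that] by (simp add: p_def)
  define N where "N = (\<Sum>e\<in>edges (chain k). (x e - (\<Sum>v\<in>e. y v) / 2)\<^sup>2)"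
  have "N \<ge> 0" unfolding N_def by (intro sum_nonneg) auto
  have form: "(\<Sum>(e, f)\<in>parcs (line_graph (chain k)). x e * x f) = (\<Sum>i<k. Q i) / 2 - 2 * N"
  proof -
    have "(\<Sum>e\<in>edges (chain k). (\<Sum>v\<in>e. y v)\<^sup>2) = (\<Sum>i<k. \<Sum>(a, b)\<in>block. (p i a + p i b)\<^sup>2)"
    proof -
      have "(\<Sum>i<k - 1. (sum y {14 * i, 14 * i + 14})\<^sup>2) = 0"
        \<comment> \<open>The upper end \<open>14 * i + 14\<close> is vertex 0 of copy
          \<open>Suc i\<close>, which exists because \<open>i < k - 1\<close>.\<close>
        using join[of "Suc _"] join by (intro sum.neutral) (auto simp: add.commute)
      moreover have "(sum y {14 * i + a, 14 * i + b})\<^sup>2 = (p i a + p i b)\<^sup>2"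
        if "(a, b) \<in> block" for i a b
        using block_less[OF that] by (simp add: p_def)
      ultimately show ?thesis
        unfolding sum_edges_chain by (auto intro!: sum.cong)
    qed
    moreover have "(\<Sum>v\<in>pverts (chain k). (y v)\<^sup>2) = (\<Sum>i<k. \<Sum>j<14. (p i j)\<^sup>2)"
      unfolding chain_simps sum_vertices_chain by (simp add: p_def)
    ultimately have "(\<Sum>i<k. Q i) = (\<Sum>e\<in>edges (chain k). (\<Sum>v\<in>e. y v)\<^sup>2)
        - 2 * (\<Sum>v\<in>pverts (chain k). (y v)\<^sup>2)"
      by (simp add: Q_def sum_subtractf sum_distrib_left)
    thus ?thesis
      unfolding N_def line_graph_quadratic_form_eq[OF chain_wf, of x] y_def[abs_def] by simp
  qed
  have "(\<Sum>i<k. Q i) \<le> 0" using Q0 by (intro sum_nonpos) auto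
  \<comment> \<open>If the block forms vanish, all vertex sums \<open>y\<close> are 0; if
    \<open>N\<close> vanishes too, each \<open>x e\<close> is half the sum of \<open>y\<close> over
    its ends, hence 0.\<close>
  moreover have "\<not> ((\<Sum>i<k. Q i) = 0 \<and> N = 0)"
  proof
    assume *: "(\<Sum>i<k. Q i) = 0 \<and> N = 0"
    hence "Q i = 0" if "i < k" for i
      using sum_nonneg_eq_0_iff[of "{..<k}" "\<lambda>i. - Q i"] Q0 that by (auto simp: sum_negf)
    hence "p i j = 0" if "i < k" "j < 14" for i j
      using block_negative(2)[OF eqs[OF that(1)] _ that(2)] that(1) by (auto simp: Q_def)
    hence y0: "y v = 0" if "v < 14 * k" for v
      using that by (metis mult_div_mod_eq p_def less_mult_imp_div_less mult.commute mod_less_divisor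
          zero_less_numeral)
    have "x e = 0" if "e \<in> edges (chain k)" for e
    proof -
      have "(\<Sum>v\<in>e. y v) = 0"
        using that chain_wf(3)[of k] by (intro sum.neutral) (auto simp: edges_def chain_simps intro!: y0)
      moreover have "(x e - (\<Sum>v\<in>e. y v) / 2)\<^sup>2 = 0"
        using * that finite_edges[OF chain_wf(2)] unfolding N_def by (simp add: sum_nonneg_eq_0_iff)
      ultimately show ?thesis by simp
    qed
    thus False using nz by blast
  qed
  ultimately show ?thesis unfolding form using \<open>N \<ge> 0\<close> by linarith
qed

text \<open>The codimensions \<open>7 * k + (k - 1) = 8 * k - 1\<close> and \<open>9 * k\<close> add
  up to the number \<open>17 * k - 1\<close> of edges, as the inertia criterion demands.\<close>

lemma line_graph_chain_inertia:
  assumes "k \<ge> 1"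
  shows "n_pos (line_graph (chain k)) = 9 * k" "n_neg (line_graph (chain k)) = 8 * k - 1"
proof -
  have V: "pverts (line_graph (chain k)) = edges (chain k)" by (simp add: line_graph_def)
  have H: "pair_graph (line_graph (chain k))"
    by (rule pair_graph_line_graph[OF pair_graph_chain])
  have card: "card (edge_forms k) \<le> 8 * k - 1" "9 * k + (8 * k - 1) = card (pverts (line_graph (chain k)))"
    using card_edge_forms[of k] assms card_edges_chain[OF assms] unfolding V by linarith+
  have pos: "0 < (\<Sum>(e, f)\<in>parcs (line_graph (chain k)). x e * x f)"
    if "\<And>g. g \<in> edge_forms k \<Longrightarrow> g x = 0" "\<exists>e\<in>pverts (line_graph (chain k)). x e \<noteq> 0" for x
    by (rule chain_positive) (use that in \<open>auto simp: V\<close>)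
  have neg: "(\<Sum>(e, f)\<in>parcs (line_graph (chain k)). x e * x f) < 0"
    if "\<And>g. g \<in> vertex_forms k \<Longrightarrow> g x = 0" "\<exists>e\<in>pverts (line_graph (chain k)). x e \<noteq> 0" for x
    by (rule chain_negative) (use that in \<open>auto simp: V\<close>)
  show "n_pos (line_graph (chain k)) = 9 * k"
    by (rule pair_graph_inertia(1)[OF H finite_edge_forms _ finite_vertex_forms _ _ _
          card(1) card_vertex_forms card(2)])
      (blast intro: linear_form_edge_forms linear_form_vertex_forms pos neg)+
  show "n_neg (line_graph (chain k)) = 8 * k - 1"
    by (rule pair_graph_inertia(2)[OF H finite_edge_forms _ finite_vertex_forms _ _ _
          card(1) card_vertex_forms card(2)])
      (blast intro: linear_form_edge_forms linear_form_vertex_forms pos neg)+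
qed

theorem corollary6:
  shows "(\<forall>k::nat. k \<ge> 1 \<longrightarrow>
            (\<exists>G :: nat pair_pre_digraph.
               pair_graph G \<and> connected G \<and> card (pverts G) = 14 * k \<and>
               signature (line_graph G) = int k + 1))
       \<and> (SUP G \<in> {G :: nat pair_pre_digraph. pair_graph G \<and> connected G}.
            ereal (real_of_int (signature (line_graph G)))) = \<infinity>
       \<and> \<not> (\<exists>C::real. \<forall>G :: nat pair_pre_digraph. pair_graph G \<and> connected G \<longrightarrow>
               real (n_pos (line_graph G)) \<le> real (n_neg (line_graph G)) + C)"
proof (intro conjI)
  \<comment> \<open>The difference of \<open>9 * k\<close> and \<open>8 * k - 1\<close>; the
    truncated subtraction is exact because \<open>k \<ge> 1\<close>.\<close>
  have sig: "signature (line_graph (chain k)) = int k + 1" if "k \<ge> 1" for k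
    using that by (simp add: signature_def line_graph_chain_inertia[OF that])
  note chain = pair_graph_chain connected_chain
  show "\<forall>k::nat. k \<ge> 1 \<longrightarrow> (\<exists>G :: nat pair_pre_digraph.
      pair_graph G \<and> connected G \<and> card (pverts G) = 14 * k \<and> signature (line_graph G) = int k + 1)"
    using chain sig by (auto simp: chain_simps intro!: exI[of _ "chain _"])
  show "(SUP G \<in> {G :: nat pair_pre_digraph. pair_graph G \<and> connected G}.
      ereal (real_of_int (signature (line_graph G)))) = \<infinity>"
  proof (rule SUP_PInfty)
    fix n :: nat
    \<comment> \<open>With \<open>Suc n\<close> copies the chain is nonempty and has signature
      \<open>n + 2\<close>.\<close>
    have "ereal (real n) \<le> ereal (real_of_int (signature (line_graph (chain (Suc n)))))"
      using sig[of "Suc n"] by simp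
    thus "\<exists>G\<in>{G :: nat pair_pre_digraph. pair_graph G \<and> connected G}.
        ereal (real n) \<le> ereal (real_of_int (signature (line_graph G)))"
      using chain by (intro bexI[of _ "chain (Suc n)"]) auto
  qed
  show "\<not> (\<exists>C::real. \<forall>G :: nat pair_pre_digraph. pair_graph G \<and> connected G \<longrightarrow>
      real (n_pos (line_graph G)) \<le> real (n_neg (line_graph G)) + C)"
  proof
    assume "\<exists>C::real. \<forall>G :: nat pair_pre_digraph. pair_graph G \<and> connected G \<longrightarrow>
      real (n_pos (line_graph G)) \<le> real (n_neg (line_graph G)) + C"
    then obtain C :: real where C: "\<And>G :: nat pair_pre_digraph. pair_graph G \<Longrightarrow> connected G \<Longrightarrow>
      real (n_pos (line_graph G)) \<le> real (n_neg (line_graph G)) + C" by blast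
    obtain n :: nat where n: "C < real n" using reals_Archimedean2 by blast
    have "real (n_pos (line_graph (chain (Suc n)))) \<le> real (n_neg (line_graph (chain (Suc n)))) + C"
      using C chain by simp
    moreover have "real (n_pos (line_graph (chain (Suc n)))) - real (n_neg (line_graph (chain (Suc n))))
        = real n + 2"
      using line_graph_chain_inertia[of "Suc n"] by simp
    ultimately show False using n by linarith
  qed
qed

end
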